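(* Let $G$ be a non-trivial finite group, let $n$ be an integer, let $P$ be a $G$-poset such that $\|\Delta(P)\|$ is $n$-connected, and let $Q$ be a free $G$-poset with $\chi\left(\widetilde{C}_Q\right)\leq n+1$. Then: (a) there is no continuous $G$-equivariant map from $\|\Delta(P)\|$ to $\|\Delta(Q)\|$; (b) if $\lambda:P\to Q$ is a map with $\lambda(g\cdot x)=g\cdot\lambda(x)$ for all $g\in G$, $x\in P$, then there exist comparable elements $x,y$ of $P$ such that $\lambda(x)$ and $\lambda(y)$ are not comparable in $Q$.
   Context: A $G$-poset is a partially ordered set with an action of $G$ preserving the order ($x\preceq y\Rightarrow g\cdot x\preceq g\cdot y$); it is free if $g\cdot x=x$ implies $g=e$ (the identity). For $x$ in a $G$-poset, $[x]=\{g\cdot x:g\in G\}$. The strong compatibility graph $\widetilde{C}_Q$ of a $G$-poset $Q$ has vertex set $Q$, with $x,y$ adjacent if there is $g\in G\setminus\{e\}$ such that $x$ and $g\cdot y$ are comparable in $Q$ and $y\notin[x]$. $\Delta(P)$ is the order complex of $P$ (simplices are chains of $P$) with the induced $G$-action; $\|\cdot\|$ is geometric realization. A space is $k$-connected if its homotopy groups $\pi_0,\dots,\pi_k$ are trivial ($(-1)$-connected means nonempty). $\chi$ is the chromatic number. *)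

theory Defs
  imports "HOL-Analysis.Analysis" "HOL-Algebra.Group_Action"
begin

definition G_poset :: "('g, 'm) monoid_scheme \<Rightarrow> 'a set \<Rightarrow> 'a rel \<Rightarrow> ('g \<Rightarrow> 'a \<Rightarrow> 'a) \<Rightarrow> bool" where
  "G_poset G P R act \<longleftrightarrow>
     group_action G P act \<and> partial_order_on P R \<and>
     (\<forall>g\<in>carrier G. \<forall>x\<in>P. \<forall>y\<in>P. (x, y) \<in> R \<longrightarrow> (act g x, act g y) \<in> R)"

definition free_G_poset :: "('g, 'm) monoid_scheme \<Rightarrow> 'a set \<Rightarrow> 'a rel \<Rightarrow> ('g \<Rightarrow> 'a \<Rightarrow> 'a) \<Rightarrow> bool" where
  "free_G_poset G P R act \<longleftrightarrow>
     G_poset G P R act \<and> (\<forall>g\<in>carrier G. \<forall>x\<in>P. act g x = x \<longrightarrow> g = \<one>\<^bsub>G\<^esub>)"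

definition comparable :: "'a rel \<Rightarrow> 'a \<Rightarrow> 'a \<Rightarrow> bool" where
  "comparable R x y \<longleftrightarrow> (x, y) \<in> R \<or> (y, x) \<in> R"

definition strong_compat_adj ::
  "('g, 'm) monoid_scheme \<Rightarrow> 'a set \<Rightarrow> 'a rel \<Rightarrow> ('g \<Rightarrow> 'a \<Rightarrow> 'a) \<Rightarrow> 'a \<Rightarrow> 'a \<Rightarrow> bool" where
  "strong_compat_adj G Q R act x y \<longleftrightarrow>
     x \<in> Q \<and> y \<in> Q \<and>
     (\<exists>g\<in>carrier G - {\<one>\<^bsub>G\<^esub>}. comparable R x (act g y)) \<and> y \<notin> orbit G act x"

definition colorable :: "'a set \<Rightarrow> ('a \<Rightarrow> 'a \<Rightarrow> bool) \<Rightarrow> nat \<Rightarrow> bool" where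
  "colorable V adj k \<longleftrightarrow>
     (\<exists>c :: 'a \<Rightarrow> nat. (\<forall>x\<in>V. c x < k) \<and> (\<forall>x\<in>V. \<forall>y\<in>V. adj x y \<longrightarrow> c x \<noteq> c y))"

definition chromatic_le :: "'a set \<Rightarrow> ('a \<Rightarrow> 'a \<Rightarrow> bool) \<Rightarrow> int \<Rightarrow> bool" where
  "chromatic_le V adj m \<longleftrightarrow> (\<exists>k::nat. int k \<le> m \<and> colorable V adj k)"

text \<open>Points of the realization of the order complex: finitely supported convex
  combinations of the vertices of a (nonempty, finite) chain of P.\<close>
definition realization :: "'a set \<Rightarrow> 'a rel \<Rightarrow> ('a \<Rightarrow> real) set" where
  "realization P R = {t. finite {x. t x \<noteq> 0} \<and> {x. t x \<noteq> 0} \<subseteq> P \<and>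
       (\<forall>x\<in>{x. t x \<noteq> 0}. \<forall>y\<in>{x. t x \<noteq> 0}. comparable R x y) \<and>
       (\<forall>x. 0 \<le> t x) \<and> sum t {x. t x \<noteq> 0} = 1}"

definition closed_simplex :: "'a set \<Rightarrow> 'a rel \<Rightarrow> 'a set \<Rightarrow> ('a \<Rightarrow> real) set" where
  "closed_simplex P R \<sigma> = {t \<in> realization P R. {x. t x \<noteq> 0} \<subseteq> \<sigma>}"

definition is_finite_chain :: "'a set \<Rightarrow> 'a rel \<Rightarrow> 'a set \<Rightarrow> bool" where
  "is_finite_chain P R \<sigma> \<longleftrightarrow> finite \<sigma> \<and> \<sigma> \<subseteq> P \<and> (\<forall>x\<in>\<sigma>. \<forall>y\<in>\<sigma>. comparable R x y)"

text \<open>The geometric realization with the (weak / coherent) CW topology: a set is open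
  iff its trace on every closed simplex is open in the Euclidean topology of that simplex.\<close>
definition geom_real :: "'a set \<Rightarrow> 'a rel \<Rightarrow> ('a \<Rightarrow> real) topology" where
  "geom_real P R = topology (\<lambda>U. U \<subseteq> realization P R \<and>
      (\<forall>\<sigma>. is_finite_chain P R \<sigma> \<longrightarrow>
          openin (subtopology (powertop_real UNIV) (closed_simplex P R \<sigma>))
                 (U \<inter> closed_simplex P R \<sigma>)))"

text \<open>Induced action of G on the realization: g moves weight at x to g x.\<close>
definition real_act :: "('g, 'm) monoid_scheme \<Rightarrow> 'a set \<Rightarrow> ('g \<Rightarrow> 'a \<Rightarrow> 'a) \<Rightarrow> 'g \<Rightarrow> ('a \<Rightarrow> real) \<Rightarrow> ('a \<Rightarrow> real)" where
  "real_act G P act g t = (\<lambda>y. if y \<in> P then t (act (inv\<^bsub>G\<^esub> g) y) else 0)"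

definition sphere_base :: "nat \<Rightarrow> real" where
  "sphere_base = (\<lambda>i. if i = 0 then 1 else 0)"

definition homotopy_group_trivial :: "'b topology \<Rightarrow> nat \<Rightarrow> 'b \<Rightarrow> bool" where
  "homotopy_group_trivial X k x0 \<longleftrightarrow>
     (\<forall>f. continuous_map (nsphere k) X f \<and> f sphere_base = x0 \<longrightarrow>
          homotopic_with (\<lambda>h. h sphere_base = x0) (nsphere k) X f (\<lambda>_. x0))"

definition n_connected :: "int \<Rightarrow> 'b topology \<Rightarrow> bool" where
  "n_connected n X \<longleftrightarrow>
     (n \<ge> -1 \<longrightarrow> topspace X \<noteq> {}) \<and>
     (\<forall>k::nat. int k \<le> n \<longrightarrow> (\<forall>x0\<in>topspace X. homotopy_group_trivial X k x0))"

end

theory Submission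
  imports Defs "HOL-Homology.Simplices" "HOL-Number_Theory.Cong" "HOL-Algebra.Multiplicative_Group"
begin

text \<open>
  Let \<open>\<tau>\<close> be a nontrivial element of \<open>G\<close>, of order \<open>m\<close>. Choosing representatives of the
  \<open>\<tau>\<close>-orbits of \<open>Q\<close>, a proper colouring of the strong compatibility graph gives an equivariant
  labelling of \<open>Q\<close> by \<open>\<int>/m \<times> {0..n}\<close> in which comparable elements of the same colour have the same
  label. Either kind of map in the theorem thus yields a \<open>\<tau>\<close>-equivariant map \<open>\<phi>\<close> from
  the realization \<open>X\<close> of \<open>P\<close> to the \<open>n\<close>-dimensional join of \<open>n + 1\<close> copies of \<open>\<int>/m\<close>.

  Since \<open>X\<close> is \<open>n\<close>-connected, one can choose cones over singular simplices of dimension at most \<open>n\<close>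
  compatibly with faces. Starting from a point \<open>w\<^sub>0\<close>, coning produces singular chains
  \<open>w\<^sub>0, \<dots>, w\<^bsub>n+1\<^esub>\<close> with \<open>\<partial>w\<^bsub>k+1\<^esub> = D\<^bsub>k+1\<^esub> w\<^sub>k\<close>, where \<open>D\<^sub>k\<close> is \<open>\<tau> - 1\<close> for odd and
  \<open>1 + \<tau> + \<dots> + \<tau>\<^bsup>m-1\<^esup>\<close> for even \<open>k\<close>. After subdivision, labelling each point \<open>x\<close> by a large coordinate
  of \<open>\<phi> x\<close> sends every simplex occurring in these chains to a simplex of the join. Dually there are
  alternating cochains \<open>a\<^sub>k = D\<^bsub>k+1\<^esub>\<^sup>* g\<^sub>k\<close> modulo \<open>m\<close>, with \<open>a\<^sub>0 = 1\<close> and \<open>a\<^bsub>k+1\<^esub> = \<delta>g\<^sub>k\<close>, so that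
  \<open>a\<^sub>k(w\<^sub>k)\<close> does not depend on \<open>k\<close> modulo \<open>m\<close>. It equals \<open>1\<close> for \<open>k = 0\<close> and \<open>0\<close> for \<open>k = n + 1\<close>, because the
  join has no simplices of dimension \<open>n + 1\<close>.
\<close>

section \<open>Extending maps from the boundary of a simplex\<close>

abbreviation simplex_top :: "nat \<Rightarrow> (nat \<Rightarrow> real) topology" where
  "simplex_top k \<equiv> subtopology (powertop_real UNIV) (standard_simplex k)"

definition simplex_boundary :: "nat \<Rightarrow> (nat \<Rightarrow> real) set" where
  "simplex_boundary k = {x \<in> standard_simplex k. \<exists>i\<le>k. x i = 0}"

text \<open>On a simplex this vanishes exactly on the boundary and is largest at the barycentre, so
  it serves as a collar coordinate.\<close>

definition min_coord :: "nat \<Rightarrow> (nat \<Rightarrow> real) \<Rightarrow> real" where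
  "min_coord k x = Min (x ` {..k})"

lemma continuous_map_min_coord: "continuous_map (powertop_real UNIV) euclideanreal (min_coord k)"
proof (induction k)
  case 0
  have "min_coord 0 = (\<lambda>x. x 0)"
    by (simp add: min_coord_def[abs_def])
  then show ?case
    by (auto intro!: continuous_intros)
next
  case (Suc k)
  have "min_coord (Suc k) = (\<lambda>x. min (x (Suc k)) (min_coord k x))"
    by (simp add: min_coord_def[abs_def] atMost_Suc)
  then show ?case
    using Suc by (auto intro!: continuous_intros)
qed

lemma min_coord_le: "i \<le> k \<Longrightarrow> min_coord k x \<le> x i"
  by (simp add: min_coord_def)

lemma min_coord_attained: "\<exists>i\<le>k. min_coord k x = x i"
proof -
  have "min_coord k x \<in> x ` {..k}" unfolding min_coord_def by (intro Min_in) auto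
  then show ?thesis by auto
qed

lemma min_coord_boundary:
  assumes "x \<in> simplex_boundary k" shows "min_coord k x = 0"
proof -
  have "x i \<ge> 0" for i using assms by (simp add: simplex_boundary_def standard_simplex_def)
  moreover obtain i where "i \<le> k" "x i = 0" using assms by (auto simp: simplex_boundary_def)
  ultimately show ?thesis
    by (metis min_coord_attained min_coord_le order_antisym)
qed

text \<open>The radial projection of the punctured \<open>(k+1)\<close>-simplex onto the \<open>k\<close>-sphere: the differences
  \<open>x i - x (k+1)\<close> are coordinates centred at the barycentre.\<close>

definition simplex_to_sphere :: "nat \<Rightarrow> (nat \<Rightarrow> real) \<Rightarrow> nat \<Rightarrow> real" where
  "simplex_to_sphere k x =
     (\<lambda>i. if i \<le> k then (x i - x (Suc k)) / sqrt (\<Sum>j\<le>k. (x j - x (Suc k))\<^sup>2) else 0)"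

text \<open>Inverse of \<open>simplex_to_sphere\<close> on the boundary: subtracting the minimum
  makes all coordinates nonnegative with at least one zero, and the division makes them sum to 1.
  The coordinate \<open>Suc k\<close> takes part with value 0, as it does in the differences
  \<open>x i - x (Suc k)\<close>.\<close>

definition sphere_to_boundary :: "nat \<Rightarrow> (nat \<Rightarrow> real) \<Rightarrow> nat \<Rightarrow> real" where
  "sphere_to_boundary k y =
     (\<lambda>i. if i \<le> Suc k then (y i - min_coord (Suc k) y) / (\<Sum>j\<le>Suc k. (y j - min_coord (Suc k) y)) else 0)"

text \<open>The denominator vanishes only where all coordinates agree, that is at the barycentre,
  and there the minimum is \<open>1 / (k + 2)\<close>.\<close>

lemma simplex_to_sphere_denominator:
  assumes "x \<in> standard_simplex (Suc k)" "(real k + 2) * min_coord (Suc k) x < 1"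
  shows "(\<Sum>j\<le>k. (x j - x (Suc k))\<^sup>2) > 0"
proof (rule ccontr)
  assume "\<not> ?thesis"
  then have "(\<Sum>j\<le>k. (x j - x (Suc k))\<^sup>2) = 0"
    by (meson antisym_conv3 sum_nonneg zero_le_power2 not_le order.asym)
  then have "x j = x (Suc k)" if "j \<le> k" for j
    using that by (simp add: sum_nonneg_eq_0_iff)
  then have eq: "x j = x (Suc k)" if "j \<le> Suc k" for j
    using that le_Suc_eq by auto
  then have "min_coord (Suc k) x = x (Suc k)"
    by (metis min_coord_attained)
  moreover have "(\<Sum>j\<le>Suc k. x j) = (\<Sum>j\<le>Suc k. x (Suc k))"
    by (rule sum.cong[OF refl eq]) simp
  moreover have "(\<Sum>j\<le>Suc k. x j) = 1"
    using assms by (simp add: standard_simplex_def)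
  ultimately have "(real k + 2) * min_coord (Suc k) x = 1"
    by (simp add: algebra_simps)
  then show False using assms by simp
qed

lemma continuous_map_simplex_to_sphere:
  "continuous_map (subtopology (powertop_real UNIV)
      {x \<in> standard_simplex (Suc k). (real k + 2) * min_coord (Suc k) x < 1}) (nsphere k) (simplex_to_sphere k)"
proof -
  let ?S = "{x \<in> standard_simplex (Suc k). (real k + 2) * min_coord (Suc k) x < 1}"
  have pos: "(\<Sum>j\<le>k. (x j - x (Suc k))\<^sup>2) > 0" if "x \<in> ?S" for x
    using that simplex_to_sphere_denominator by blast
  have "(\<Sum>i\<le>k. (simplex_to_sphere k x i)\<^sup>2) = 1" if "x \<in> ?S" for x
    using pos[OF that] by (simp add: simplex_to_sphere_def power_divide flip: sum_divide_distrib)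
  moreover have "continuous_map (subtopology (powertop_real UNIV) ?S) euclideanreal
      (\<lambda>x. simplex_to_sphere k x i)" for i
  proof (cases "i \<le> k")
    case True
    have "continuous_map (subtopology (powertop_real UNIV) ?S) euclideanreal
      (\<lambda>x. (x i - x (Suc k)) / sqrt (\<Sum>j\<le>k. (x j - x (Suc k))\<^sup>2))"
      using pos by (intro continuous_intros) fastforce+
    then show ?thesis using True by (simp add: simplex_to_sphere_def)
  qed (simp add: simplex_to_sphere_def)
  ultimately show ?thesis
    by (auto simp: nsphere continuous_map_in_subtopology continuous_map_componentwise_UNIV simplex_to_sphere_def)
qed

lemma sphere_to_boundary_denominator:
  assumes "y \<in> topspace (nsphere k)"
  shows "(\<Sum>j\<le>Suc k. (y j - min_coord (Suc k) y)) > 0"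
proof (rule ccontr)
  assume "\<not> ?thesis"
  moreover have nn: "y j - min_coord (Suc k) y \<ge> 0" if "j \<in> {..Suc k}" for j
    using that min_coord_le by simp
  ultimately have "(\<Sum>j\<le>Suc k. (y j - min_coord (Suc k) y)) = 0"
    by (meson sum_nonneg not_le antisym)
  then have eq: "\<forall>j\<in>{..Suc k}. y j - min_coord (Suc k) y = 0"
    using nn by (subst (asm) sum_nonneg_eq_0_iff) auto
  have "y (Suc k) = 0" using assms by (simp add: nsphere)
  then have "y j = 0" if "j \<le> k" for j using eq that by force
  then have "(\<Sum>i\<le>k. (y i)\<^sup>2) = 0" by simp
  then show False using assms by (simp add: nsphere)
qed

lemma continuous_map_sphere_to_boundary:
  "continuous_map (nsphere k) (subtopology (powertop_real UNIV) (simplex_boundary (Suc k))) (sphere_to_boundary k)"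
proof -
  have mem: "sphere_to_boundary k y \<in> simplex_boundary (Suc k)" if y: "y \<in> topspace (nsphere k)" for y
  proof -
    let ?s = "\<Sum>j\<le>Suc k. (y j - min_coord (Suc k) y)"
    have pos: "?s > 0" by (rule sphere_to_boundary_denominator[OF y])
    have nn: "0 \<le> sphere_to_boundary k y i" for i
      using pos min_coord_le[of i "Suc k" y] unfolding sphere_to_boundary_def
      by (auto intro!: divide_nonneg_pos)
    have sum1: "(\<Sum>i\<le>Suc k. sphere_to_boundary k y i) = 1"
      using pos by (simp add: sphere_to_boundary_def flip: sum_divide_distrib del: sum.atMost_Suc)
    have le1: "sphere_to_boundary k y i \<le> 1" for i
    proof (cases "i \<le> Suc k")
      case True
      then show ?thesis
        using sum1 member_le_sum[of i "{..Suc k}" "sphere_to_boundary k y"] nn by auto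
    qed (simp add: sphere_to_boundary_def)
    obtain i where "i \<le> Suc k" "min_coord (Suc k) y = y i" using min_coord_attained by blast
    then have "\<exists>i\<le>Suc k. sphere_to_boundary k y i = 0"
      by (auto simp: sphere_to_boundary_def intro!: exI[of _ i])
    then show ?thesis
      using nn le1 sum1 by (auto simp: simplex_boundary_def standard_simplex_def sphere_to_boundary_def)
  qed
  have mc: "continuous_map (nsphere k) euclideanreal (min_coord (Suc k))"
    unfolding nsphere by (rule continuous_map_from_subtopology[OF continuous_map_min_coord])
  have "continuous_map (nsphere k) euclideanreal (\<lambda>y. sphere_to_boundary k y i)" for i
  proof (cases "i \<le> Suc k")
    case True
    have "continuous_map (nsphere k) euclideanreal
      (\<lambda>y. (y i - min_coord (Suc k) y) / (\<Sum>j\<le>Suc k. (y j - min_coord (Suc k) y)))"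
      using sphere_to_boundary_denominator
      by (intro continuous_intros mc continuous_map_nsphere_projection) fastforce+
    then show ?thesis using True by (simp add: sphere_to_boundary_def)
  qed (simp add: sphere_to_boundary_def)
  then show ?thesis
    using mem by (auto simp: continuous_map_in_subtopology continuous_map_componentwise_UNIV)
qed

text \<open>Up to the positive factor \<open>1 / c\<close> the first map only translates along the
  diagonal. Since the minimum of \<open>x\<close> is 0, subtracting the new minimum leaves
  \<open>x i / c\<close>, and normalizing the sum removes \<open>c\<close>.\<close>

lemma sphere_to_boundary_simplex_to_sphere:
  assumes x: "x \<in> simplex_boundary (Suc k)"
  shows "sphere_to_boundary k (simplex_to_sphere k x) = x"
proof -
  let ?y = "simplex_to_sphere k x"
  define c where "c = sqrt (\<Sum>j\<le>k. (x j - x (Suc k))\<^sup>2)"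
  have m0: "min_coord (Suc k) x = 0" by (rule min_coord_boundary[OF x])
  have xs: "x \<in> standard_simplex (Suc k)" using x by (simp add: simplex_boundary_def)
  have c: "c > 0"
    unfolding c_def using simplex_to_sphere_denominator[OF xs] m0 by simp
  have y: "?y i = (x i - x (Suc k)) / c" if "i \<le> Suc k" for i
    using that by (auto simp: simplex_to_sphere_def c_def le_Suc_eq)
  have my: "min_coord (Suc k) ?y = - x (Suc k) / c"
  proof (rule antisym)
    obtain i where i: "i \<le> Suc k" "x i = 0" using x by (auto simp: simplex_boundary_def)
    show "min_coord (Suc k) ?y \<le> - x (Suc k) / c"
      using min_coord_le[OF i(1), of ?y] y[OF i(1)] i(2) by simp
    obtain j where j: "j \<le> Suc k" "min_coord (Suc k) ?y = ?y j" using min_coord_attained by blast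
    have "x j \<ge> 0" using xs by (simp add: standard_simplex_def)
    then show "- x (Suc k) / c \<le> min_coord (Suc k) ?y"
      using y[OF j(1)] j(2) c by (simp add: diff_divide_distrib)
  qed
  have d: "?y i - min_coord (Suc k) ?y = x i / c" if "i \<le> Suc k" for i
    unfolding my y[OF that] by (simp add: diff_divide_distrib)
  have "(\<Sum>j\<le>Suc k. (?y j - min_coord (Suc k) ?y)) = (\<Sum>j\<le>Suc k. x j / c)"
    by (rule sum.cong) (use d in auto)
  also have "\<dots> = 1 / c"
    using xs by (simp add: standard_simplex_def flip: sum_divide_distrib del: sum.atMost_Suc)
  finally have s: "(\<Sum>j\<le>Suc k. (?y j - min_coord (Suc k) ?y)) = 1 / c" .
  show ?thesis
  proof
    fix i
    show "sphere_to_boundary k ?y i = x i"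
    proof (cases "i \<le> Suc k")
      case True
      then have "sphere_to_boundary k ?y i = (x i / c) / (1 / c)"
        unfolding sphere_to_boundary_def s d[OF True] by simp
      then show ?thesis using c by simp
    next
      case False
      then show ?thesis using xs by (simp add: sphere_to_boundary_def standard_simplex_def)
    qed
  qed
qed

lemma sphere_base_in_nsphere: "sphere_base \<in> topspace (nsphere k)"
  using in_topspace_nsphere by (simp add: sphere_base_def)

text \<open>A null-homotopy of \<open>f\<close> transported to the sphere is run through a collar of
  the boundary; the rest of the simplex goes to the base point.\<close>

lemma extend_from_simplex_boundary:
  fixes X :: "'a topology"
  assumes f: "continuous_map (subtopology (powertop_real UNIV) (simplex_boundary (Suc k))) X f"
    and triv: "\<And>x0. x0 \<in> topspace X \<Longrightarrow> homotopy_group_trivial X k x0"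
  obtains F where "continuous_map (simplex_top (Suc k)) X F"
    "\<And>x. x \<in> simplex_boundary (Suc k) \<Longrightarrow> F x = f x"
proof -
  define x0 where "x0 = f (sphere_to_boundary k sphere_base)"
  have fs: "continuous_map (nsphere k) X (f \<circ> sphere_to_boundary k)"
    by (rule continuous_map_compose[OF continuous_map_sphere_to_boundary f])
  then have x0: "x0 \<in> topspace X"
    using sphere_base_in_nsphere unfolding x0_def by (fastforce simp: continuous_map_def)
  have "homotopic_with (\<lambda>h. h sphere_base = x0) (nsphere k) X (f \<circ> sphere_to_boundary k) (\<lambda>_. x0)"
    using triv[OF x0] fs unfolding homotopy_group_trivial_def x0_def by simp
  then obtain H :: "real \<times> (nat \<Rightarrow> real) \<Rightarrow> 'a" where H: "continuous_map (prod_topology (top_of_set {0..1}) (nsphere k)) X H"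
    and H0: "\<And>y. H (0, y) = f (sphere_to_boundary k y)" and H1: "\<And>y. H (1, y) = x0"
    unfolding homotopic_with_def by auto
  \<comment> \<open>The factor 2 makes the homotopy end halfway to the barycentre, so
    \<open>simplex_to_sphere\<close> is continuous wherever it is applied.\<close>
  define p where "p = (\<lambda>x. 2 * (real k + 2) * min_coord (Suc k) x)"
  define F where "F = (\<lambda>x. if p x \<le> 1 then H (p x, simplex_to_sphere k x) else x0)"
  have p_cont: "continuous_map (simplex_top (Suc k)) euclideanreal p"
    unfolding p_def
    by (intro continuous_intros continuous_map_from_subtopology[OF continuous_map_min_coord])
  have p_nonneg: "p x \<ge> 0" if "x \<in> standard_simplex (Suc k)" for x
  proof -
    obtain i where "min_coord (Suc k) x = x i" using min_coord_attained by blast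
    then show ?thesis using that by (simp add: p_def standard_simplex_def)
  qed
  have "continuous_map (simplex_top (Suc k)) X F"
    unfolding F_def
  proof (rule continuous_map_cases_le)
    let ?T = "{x \<in> topspace (simplex_top (Suc k)). p x \<le> 1}"
    have Teq: "subtopology (simplex_top (Suc k)) ?T = subtopology (powertop_real UNIV) ?T"
      by (simp add: subtopology_subtopology Collect_conj_eq Int_absorb1)
    have "continuous_map (subtopology (powertop_real UNIV) ?T) (top_of_set {0..1}) p"
      using p_nonneg continuous_map_from_subtopology[OF p_cont, of ?T] unfolding Teq
      by (auto simp: continuous_map_in_subtopology)
    moreover have "continuous_map (subtopology (powertop_real UNIV) ?T) (nsphere k) (simplex_to_sphere k)"
      by (rule continuous_map_from_subtopology_mono[OF continuous_map_simplex_to_sphere])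
         (auto simp: p_def algebra_simps)
    ultimately have "continuous_map (subtopology (powertop_real UNIV) ?T)
        (prod_topology (top_of_set {0..1}) (nsphere k)) (\<lambda>x. (p x, simplex_to_sphere k x))"
      by (rule continuous_map_pairedI)
    from continuous_map_compose[OF this H]
    show "continuous_map (subtopology (simplex_top (Suc k)) ?T) X (\<lambda>x. H (p x, simplex_to_sphere k x))"
      unfolding Teq by (simp add: o_def)
  qed (use p_cont x0 H1 in auto)
  moreover have "F x = f x" if "x \<in> simplex_boundary (Suc k)" for x
    using min_coord_boundary[OF that] sphere_to_boundary_simplex_to_sphere[OF that]
    by (simp add: F_def p_def H0)
  ultimately show thesis using that by blast
qed

section \<open>Singular simplices with prescribed faces\<close>

definition drop_coord :: "nat \<Rightarrow> (nat \<Rightarrow> 'a) \<Rightarrow> nat \<Rightarrow> 'a" where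
  "drop_coord j x = (\<lambda>i. if i < j then x i else x (Suc i))"

lemma simplical_face_drop_coord:
  "x j = 0 \<Longrightarrow> simplical_face j (drop_coord j x) = x"
  by (auto simp: simplical_face_def drop_coord_def fun_eq_iff)

lemma drop_coord_simplical_face: "drop_coord j (simplical_face j x) = x"
  by (auto simp: simplical_face_def drop_coord_def fun_eq_iff)

lemma drop_coord_in_standard_simplex:
  assumes x: "x \<in> standard_simplex (Suc k)" and j: "j \<le> Suc k" "x j = 0"
  shows "drop_coord j x \<in> standard_simplex k"
proof -
  have "(\<Sum>i\<le>Suc k. x i) = (\<Sum>i\<in>{..Suc k} - {j}. x i)"
    using j by (intro sum.mono_neutral_right) auto
  also have "\<dots> = (\<Sum>i\<le>k. drop_coord j x i)"
  proof (rule sum.reindex_bij_witness[of _ "\<lambda>i. if i < j then i else Suc i" "\<lambda>i. if i < j then i else i - 1"])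
  qed (use j in \<open>auto simp: drop_coord_def\<close>)
  finally show ?thesis
    using x j by (auto simp: standard_simplex_def drop_coord_def)
qed

text \<open>The condition \<open>compat\<close> is the simplicial identity; it makes the prescribed
  faces agree on their overlaps. They glue along a finite closed cover of the boundary, and the
  vanishing of the \<open>k\<close>-th homotopy groups fills the interior.\<close>

lemma singular_simplex_with_faces:
  assumes tau: "\<And>j. j \<le> Suc k \<Longrightarrow> singular_simplex k X (\<tau> j)"
    and compat: "\<And>i j. 1 \<le> k \<Longrightarrow> i < j \<Longrightarrow> j \<le> Suc k \<Longrightarrow>
        singular_face k i (\<tau> j) = singular_face k (j - 1) (\<tau> i)"
    and triv: "\<And>x0. x0 \<in> topspace X \<Longrightarrow> homotopy_group_trivial X k x0"
  obtains \<sigma> where "singular_simplex (Suc k) X \<sigma>" "\<And>j. j \<le> Suc k \<Longrightarrow> singular_face (Suc k) j \<sigma> = \<tau> j"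
proof -
  let ?B = "subtopology (powertop_real UNIV) (simplex_boundary (Suc k))"
  define T where "T j = {x \<in> simplex_boundary (Suc k). x j = 0}" for j
  have agree: "(\<tau> i \<circ> drop_coord i) x = (\<tau> j \<circ> drop_coord j) x"
    if ij: "i < j" "j \<le> Suc k" and x: "x \<in> T i" "x \<in> T j" for i j x
  proof -
    have xs: "x \<in> standard_simplex (Suc k)" and x0: "x i = 0" "x j = 0"
      using x by (auto simp: T_def simplex_boundary_def)
    \<comment> \<open>The two faces of an interval are disjoint, so there is nothing to compare when
      \<open>k = 0\<close>.\<close>
    have k1: "1 \<le> k"
    proof (rule ccontr)
      assume "\<not> 1 \<le> k"
      then have "k = 0" "i = 0" "j = 1" using ij by auto
      then show False using xs x0 by (simp add: standard_simplex_def)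
    qed
    then obtain k' where k': "k = Suc k'" using not0_implies_Suc by fastforce
    \<comment> \<open>The same point of the codimension-two face arises by dropping \<open>j\<close>
      and then \<open>i\<close>, or \<open>i\<close> and then \<open>j - 1\<close>, the index having
      moved down.\<close>
    define z where "z = drop_coord i (drop_coord j x)"
    have zj: "drop_coord j x = simplical_face i z"
      unfolding z_def using x0 ij by (subst simplical_face_drop_coord) (auto simp: drop_coord_def)
    have z_alt: "z = drop_coord (j - 1) (drop_coord i x)"
      using ij by (auto simp: z_def drop_coord_def fun_eq_iff)
    have zi: "drop_coord i x = simplical_face (j - 1) z"
      unfolding z_alt using x0 ij by (subst simplical_face_drop_coord) (auto simp: drop_coord_def)
    have zs: "z \<in> standard_simplex (k - Suc 0)"
    proof -
      have "drop_coord j x \<in> standard_simplex (Suc k')"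
        using drop_coord_in_standard_simplex[OF xs ij(2) x0(2)] k' by simp
      moreover have "i \<le> Suc k'" "drop_coord j x i = 0"
        using x0 ij k' by (auto simp: drop_coord_def)
      ultimately show ?thesis
        unfolding z_def k' diff_Suc_Suc diff_zero by (rule drop_coord_in_standard_simplex)
    qed
    have "\<tau> j (drop_coord j x) = singular_face k i (\<tau> j) z"
      using zs by (simp add: singular_face_def zj)
    also have "\<dots> = singular_face k (j - 1) (\<tau> i) z"
      using compat[OF k1 ij] by simp
    also have "\<dots> = \<tau> i (drop_coord i x)"
      using zs by (simp add: singular_face_def zi)
    finally show ?thesis by simp
  qed
  have agree': "(\<tau> i \<circ> drop_coord i) x = (\<tau> j \<circ> drop_coord j) x"
    if "i \<le> Suc k" "j \<le> Suc k" "x \<in> T i" "x \<in> T j" for i j x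
    using agree[of i j x] agree[of j i x] that by (metis nat_neq_iff)
  have Tcont: "continuous_map (subtopology ?B (T j)) X (\<tau> j \<circ> drop_coord j)" if j: "j \<le> Suc k" for j
  proof (rule continuous_map_compose)
    show "continuous_map (simplex_top k) X (\<tau> j)"
      using tau[OF j] by (simp add: singular_simplex_def)
    have "continuous_map (subtopology ?B (T j)) euclideanreal (\<lambda>x. drop_coord j x i)" for i
      unfolding drop_coord_def subtopology_subtopology
      by (cases "i < j") (auto intro!: continuous_intros)
    moreover have "drop_coord j x \<in> standard_simplex k" if "x \<in> T j" for x
      using that j by (auto simp: T_def simplex_boundary_def intro!: drop_coord_in_standard_simplex)
    ultimately show "continuous_map (subtopology ?B (T j)) (simplex_top k) (drop_coord j)"
      by (auto simp: continuous_map_in_subtopology continuous_map_componentwise_UNIV)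
  qed
  have Tclosed: "closedin ?B (T j)" for j
  proof -
    have "closedin (powertop_real UNIV) {x \<in> topspace (powertop_real UNIV). x j \<in> {0::real}}"
      by (rule closedin_continuous_map_preimage[OF continuous_map_product_projection]) auto
    moreover have "T j = {x \<in> topspace (powertop_real UNIV). x j \<in> {0::real}} \<inter> simplex_boundary (Suc k)"
      by (auto simp: T_def)
    ultimately show ?thesis by (auto simp: closedin_subtopology)
  qed
  obtain f where f: "continuous_map ?B X f"
    and f_eq: "\<And>x i. \<lbrakk>i \<in> {..Suc k}; x \<in> topspace ?B \<inter> T i\<rbrakk> \<Longrightarrow> f x = (\<tau> i \<circ> drop_coord i) x"
  proof (rule pasting_lemma_exists_closed[of "{..Suc k}" ?B T X "\<lambda>j. \<tau> j \<circ> drop_coord j"])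
    show "topspace ?B \<subseteq> \<Union> (T ` {..Suc k})"
      by (auto simp: T_def simplex_boundary_def)
    show "continuous_map (subtopology ?B (T j)) X (\<tau> j \<circ> drop_coord j)" if "j \<in> {..Suc k}" for j
      using Tcont that by simp
    show "(\<tau> i \<circ> drop_coord i) x = (\<tau> j \<circ> drop_coord j) x"
      if "i \<in> {..Suc k}" "j \<in> {..Suc k}" "x \<in> topspace ?B \<inter> T i \<inter> T j" for i j x
      using that by (intro agree') auto
  qed (use Tclosed in simp_all)
  obtain F where F: "continuous_map (simplex_top (Suc k)) X F"
    and F_eq: "\<And>x. x \<in> simplex_boundary (Suc k) \<Longrightarrow> F x = f x"
    using extend_from_simplex_boundary[OF f triv] by blast
  define \<sigma> where "\<sigma> = restrict F (standard_simplex (Suc k))"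
  have "singular_simplex (Suc k) X \<sigma>"
    using F by (simp add: singular_simplex_def \<sigma>_def continuous_map_eq[of _ _ F])
  moreover have "singular_face (Suc k) j \<sigma> = \<tau> j" if j: "j \<le> Suc k" for j
  proof
    fix x
    show "singular_face (Suc k) j \<sigma> x = \<tau> j x"
    proof (cases "x \<in> standard_simplex k")
      case True
      have s: "simplical_face j x \<in> standard_simplex (Suc k)"
        using simplical_face_in_standard_simplex[of "Suc k" j x] j True by simp
      moreover have z: "simplical_face j x j = 0" by (simp add: simplical_face_def)
      ultimately have b: "simplical_face j x \<in> simplex_boundary (Suc k)" "simplical_face j x \<in> T j"
        using j by (auto simp: simplex_boundary_def T_def)
      show ?thesis
        using True s b j by (simp add: singular_face_def \<sigma>_def F_eq f_eq drop_coord_simplical_face)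
    next
      case False
      then show ?thesis
        using tau[OF j] by (simp add: singular_face_def singular_simplex_def extensional_def)
    qed
  qed
  ultimately show thesis using that by blast
qed

section \<open>Chains over the periodic resolution\<close>

lemma singular_face_singular_face:
  assumes "i \<le> j" "j \<le> Suc p"
  shows "singular_face (Suc p) i (singular_face (Suc (Suc p)) (Suc j) g)
       = singular_face (Suc p) j (singular_face (Suc (Suc p)) i g)"
proof
  fix t
  show "singular_face (Suc p) i (singular_face (Suc (Suc p)) (Suc j) g) t
      = singular_face (Suc p) j (singular_face (Suc (Suc p)) i g) t"
  proof (cases "t \<in> standard_simplex p")
    case True
    have "simplical_face i t \<in> standard_simplex (Suc p)" "simplical_face j t \<in> standard_simplex (Suc p)"
      using True assms simplical_face_in_standard_simplex[of "Suc p"] by auto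
    moreover have "simplical_face (Suc j) (simplical_face i t) = simplical_face i (simplical_face j t)"
      using assms by (auto simp: simplical_face_def fun_eq_iff)
    ultimately show ?thesis by (simp add: singular_face_def)
  qed (simp add: singular_face_def)
qed

section \<open>Coherent cones in a highly connected space\<close>

definition const_simplex :: "nat \<Rightarrow> 'a \<Rightarrow> (nat \<Rightarrow> real) \<Rightarrow> 'a" where
  "const_simplex p x = restrict (\<lambda>_. x) (standard_simplex p)"

lemma singular_simplex_const_simplex:
  "x \<in> topspace X \<Longrightarrow> singular_simplex p X (const_simplex p x)"
  by (simp add: singular_simplex_def const_simplex_def)

text \<open>A choice, for every singular simplex, of a cone over it with apex \<open>x\<^sub>0\<close>, compatible with faces.\<close>

primrec cone_choice :: "'a topology \<Rightarrow> 'a \<Rightarrow> nat \<Rightarrow> ((nat \<Rightarrow> real) \<Rightarrow> 'a) \<Rightarrow> (nat \<Rightarrow> real) \<Rightarrow> 'a" where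
  "cone_choice X x0 0 s = (SOME c. singular_simplex 1 X c \<and> singular_face 1 0 c = s \<and>
      singular_face 1 1 c = const_simplex 0 x0)"
| "cone_choice X x0 (Suc k) s = (SOME c. singular_simplex (Suc (Suc k)) X c \<and>
      singular_face (Suc (Suc k)) 0 c = s \<and>
      (\<forall>j\<le>Suc k. singular_face (Suc (Suc k)) (Suc j) c = cone_choice X x0 k (singular_face (Suc k) j s)))"

text \<open>The faces demanded of a cone over \<open>s\<close> are \<open>s\<close> itself and the
  cones already chosen over the faces of \<open>s\<close>, or the apex when \<open>k = 0\<close>. By
  induction they satisfy the simplicial identities, so a filling exists and the choice operator
  selects one.\<close>

lemma cone_choice:
  assumes triv: "\<And>q x. q \<le> k \<Longrightarrow> x \<in> topspace X \<Longrightarrow> homotopy_group_trivial X q x"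
    and x0: "x0 \<in> topspace X" and "singular_simplex k X s"
  shows "singular_simplex (Suc k) X (cone_choice X x0 k s) \<and>
    singular_face (Suc k) 0 (cone_choice X x0 k s) = s \<and>
    (\<forall>j\<le>k. singular_face (Suc k) (Suc j) (cone_choice X x0 k s) =
       (if k = 0 then const_simplex 0 x0 else cone_choice X x0 (k - 1) (singular_face k j s)))"
  using triv \<open>singular_simplex k X s\<close>
proof (induction k arbitrary: s)
  case 0
  define \<tau> where "\<tau> j = (if j = 0 then s else const_simplex 0 x0)" for j :: nat
  have "singular_simplex 0 X (\<tau> j)" for j
    using 0 singular_simplex_const_simplex[OF x0] by (simp add: \<tau>_def)
  then obtain c where "singular_simplex (Suc 0) X c" "\<And>j. j \<le> Suc 0 \<Longrightarrow> singular_face (Suc 0) j c = \<tau> j"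
    using singular_simplex_with_faces[of 0 X \<tau>] 0(1)[of 0] by (metis le0 not_one_le_zero)
  then have "\<exists>c. singular_simplex 1 X c \<and> singular_face 1 0 c = s \<and> singular_face 1 1 c = const_simplex 0 x0"
    by (auto simp: \<tau>_def)
  from someI_ex[OF this] show ?case by simp
next
  case (Suc k)
  let ?K = "cone_choice X x0"
  define \<tau> where "\<tau> j = (if j = 0 then s else ?K k (singular_face (Suc k) (j - 1) s))" for j
  have face: "singular_simplex k X (singular_face (Suc k) j s)" if "j \<le> Suc k" for j
    using singular_simplex_singular_face[OF Suc.prems(2), of j] that by simp
  have IH: "singular_simplex (Suc k) X (?K k r)" "singular_face (Suc k) 0 (?K k r) = r"
      "\<And>j. j \<le> k \<Longrightarrow> singular_face (Suc k) (Suc j) (?K k r) =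
         (if k = 0 then const_simplex 0 x0 else ?K (k - 1) (singular_face k j r))"
    if "singular_simplex k X r" for r
    using Suc.IH[OF _ that] Suc.prems(1) by auto
  obtain c where "singular_simplex (Suc (Suc k)) X c"
    and "\<And>j. j \<le> Suc (Suc k) \<Longrightarrow> singular_face (Suc (Suc k)) j c = \<tau> j"
  proof (rule singular_simplex_with_faces[of "Suc k" X \<tau>])
    show "singular_simplex (Suc k) X (\<tau> j)" if "j \<le> Suc (Suc k)" for j
      using that Suc.prems(2) IH(1)[OF face] by (auto simp: \<tau>_def)
    show "singular_face (Suc k) i (\<tau> j) = singular_face (Suc k) (j - 1) (\<tau> i)"
      if ij: "i < j" "j \<le> Suc (Suc k)" for i j
    proof -
      obtain j' where j': "j = Suc j'" "j' \<le> Suc k" using ij by (cases j) auto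
      show ?thesis
      proof (cases i)
        case 0
        then show ?thesis using j' IH(2)[OF face[OF j'(2)]] by (simp add: \<tau>_def)
      next
        case (Suc i')
        then have i': "i' \<le> k" "Suc i' \<le> j'" using ij j' by auto
        then obtain j'' where j'': "j' = Suc j''" "i' \<le> j''" "j'' \<le> k"
          using j' by (cases j') auto
        \<comment> \<open>Both sides are the chosen cone over the same codimension-two face of
          \<open>s\<close>, or the apex if \<open>k = 0\<close>.\<close>
        have "singular_face (Suc k) (Suc i') (?K k (singular_face (Suc k) (Suc j'') s))
            = singular_face (Suc k) (Suc j'') (?K k (singular_face (Suc k) i' s))"
        proof (cases k)
          case 0
          then show ?thesis using IH(3)[OF face] i' j'' by simp
        next
          case (Suc k')
          then show ?thesis
            using IH(3)[OF face, of "Suc j''" i'] IH(3)[OF face, of i' j''] i' j''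
              singular_face_singular_face[of i' j'' k' s] by (simp del: cone_choice.simps)
        qed
        then show ?thesis using Suc j' j'' by (simp add: \<tau>_def)
      qed
    qed
  qed (use Suc.prems(1) in auto)
  then have "\<exists>c. singular_simplex (Suc (Suc k)) X c \<and> singular_face (Suc (Suc k)) 0 c = s \<and>
      (\<forall>j\<le>Suc k. singular_face (Suc (Suc k)) (Suc j) c = ?K k (singular_face (Suc k) j s))"
    by (auto simp: \<tau>_def)
  from someI_ex[OF this] show ?case by simp
qed

definition cone_chain :: "'a topology \<Rightarrow> 'a \<Rightarrow> nat \<Rightarrow> 'a chain \<Rightarrow> 'a chain" where
  "cone_chain X x0 k = frag_extend (frag_of \<circ> cone_choice X x0 k)"

lemma singular_chain_cone_chain:
  assumes "\<And>q x. q \<le> k \<Longrightarrow> x \<in> topspace X \<Longrightarrow> homotopy_group_trivial X q x"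
    and "x0 \<in> topspace X" "singular_chain k X c"
  shows "singular_chain (Suc k) X (cone_chain X x0 k c)"
  unfolding cone_chain_def
proof (rule singular_chain_extend)
  fix s assume "s \<in> Poly_Mapping.keys c"
  then have "singular_simplex k X s" using assms(3) by (auto simp: singular_chain_def)
  then show "singular_chain (Suc k) X ((frag_of \<circ> cone_choice X x0 k) s)"
    using cone_choice[OF assms(1,2)] by (simp add: singular_chain_of)
qed

text \<open>The usual cone formula: face 0 is the base and the remaining faces form the cone over
  the boundary, with one change of sign. In degree 0 that cone becomes the augmentation times the
  apex.\<close>

lemma chain_boundary_cone_chain:
  assumes triv: "\<And>q x. q \<le> k \<Longrightarrow> x \<in> topspace X \<Longrightarrow> homotopy_group_trivial X q x"
    and x0: "x0 \<in> topspace X" and "singular_chain k X c"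
  shows "chain_boundary (Suc k) (cone_chain X x0 k c) =
    c - (if k = 0 then frag_extend (\<lambda>_. frag_of (const_simplex 0 x0)) c
         else cone_chain X x0 (k - 1) (chain_boundary k c))"
  using \<open>singular_chain k X c\<close> unfolding singular_chain_def
proof (induction rule: frag_induction)
  case (one s)
  let ?c = "cone_choice X x0 k s"
  have s: "singular_face (Suc k) 0 ?c = s"
     "\<And>j. j \<le> k \<Longrightarrow> singular_face (Suc k) (Suc j) ?c =
       (if k = 0 then const_simplex 0 x0 else cone_choice X x0 (k - 1) (singular_face k j s))"
    using cone_choice[OF triv x0, of k s] one by auto
  have "chain_boundary (Suc k) (cone_chain X x0 k (frag_of s)) =
      (\<Sum>j\<le>Suc k. frag_cmul ((-1) ^ j) (frag_of (singular_face (Suc k) j ?c)))"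
    by (simp add: cone_chain_def chain_boundary_of)
  also have "\<dots> = frag_of s - (\<Sum>j\<le>k. frag_cmul ((-1) ^ j) (frag_of (singular_face (Suc k) (Suc j) ?c)))"
    unfolding sum.atMost_Suc_shift by (simp add: s sum_negf flip: minus_frag_cmul)
  also have "(\<Sum>j\<le>k. frag_cmul ((-1) ^ j) (frag_of (singular_face (Suc k) (Suc j) ?c))) =
      (if k = 0 then frag_of (const_simplex 0 x0) else cone_chain X x0 (k - 1) (chain_boundary k (frag_of s)))"
    by (simp add: s cone_chain_def chain_boundary_of frag_extend_sum frag_extend_cmul)
  finally show ?case by simp
next
  case (diff a b)
  then show ?case
    by (simp add: cone_chain_def frag_extend_diff chain_boundary_diff)
qed (simp add: cone_chain_def)

section \<open>Chains from the periodic resolution of a cyclic group\<close>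

text \<open>The differentials of the periodic resolution of the cyclic group generated by \<open>T\<close>:
  \<open>T - 1\<close> in odd degrees \<open>k + 1\<close> and the norm \<open>1 + T + \<dots> + T\<^bsup>m-1\<^esup>\<close> in even ones.\<close>

definition period_op :: "nat \<Rightarrow> ('a \<Rightarrow> 'a) \<Rightarrow> nat \<Rightarrow> nat \<Rightarrow> 'a chain \<Rightarrow> 'a chain" where
  "period_op m T k p c =
     (if even k then chain_map p T c - c else \<Sum>l<m. chain_map p (T ^^ l) c)"

lemma continuous_map_funpow: "continuous_map X X T \<Longrightarrow> continuous_map X X (T ^^ l)"
  by (induction l) (auto intro: continuous_map_compose)

lemma singular_chain_period_op:
  assumes "continuous_map X X T" "singular_chain p X c"
  shows "singular_chain p X (period_op m T k p c)"
  unfolding period_op_def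
  using assms by (auto intro!: singular_chain_diff singular_chain_sum singular_chain_chain_map continuous_map_funpow)

lemma chain_boundary_period_op:
  assumes "singular_chain (Suc p) X c"
  shows "chain_boundary (Suc p) (period_op m T k (Suc p) c) = period_op m T k p (chain_boundary (Suc p) c)"
  using chain_boundary_chain_map[OF assms, where 'b = 'a]
  by (simp add: period_op_def chain_boundary_diff chain_boundary_sum o_def)

text \<open>In either order the product of \<open>T - 1\<close> and the norm telescopes to
  \<open>T ^^ m\<close> minus the identity, which is zero on chains in \<open>X\<close>.\<close>

lemma period_op_period_op:
  assumes T: "continuous_map X X T" and per: "\<And>x. x \<in> topspace X \<Longrightarrow> (T ^^ m) x = x"
    and c: "singular_chain p X c"
  shows "period_op m T (Suc k) p (period_op m T k p c) = 0"
proof -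
  have tele: "(\<Sum>l<m. chain_map p (T ^^ Suc l) c - chain_map p (T ^^ l) c) = 0"
  proof -
    have "(\<Sum>l<m. chain_map p (T ^^ Suc l) c - chain_map p (T ^^ l) c)
        = chain_map p (T ^^ m) c - chain_map p (T ^^ 0) c"
      by (rule sum_lessThan_telescope)
    then show ?thesis
      using chain_map_id_gen[OF c, of "T ^^ m"] chain_map_id_gen[OF c, of "T ^^ 0"] per by simp
  qed
  show ?thesis
  proof (cases "even k")
    case True
    have "chain_map p (T ^^ l) (chain_map p T c) = chain_map p (T ^^ Suc l) c" for l
      unfolding funpow_Suc_right chain_map_compose by simp
    then show ?thesis
      using True tele by (simp add: period_op_def chain_map_diff)
  next
    case False
    have "chain_map p T (chain_map p (T ^^ l) c) = chain_map p (T ^^ Suc l) c" for l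
      unfolding funpow.simps chain_map_compose by simp
    then show ?thesis
      using False tele by (simp add: period_op_def chain_map_sum o_def sum_subtractf)
  qed
qed

primrec resolution_chain :: "nat \<Rightarrow> ('a \<Rightarrow> 'a) \<Rightarrow> 'a topology \<Rightarrow> 'a \<Rightarrow> nat \<Rightarrow> 'a chain" where
  "resolution_chain m T X x0 0 = frag_of (const_simplex 0 x0)"
| "resolution_chain m T X x0 (Suc k) = cone_chain X x0 k (period_op m T k k (resolution_chain m T X x0 k))"

text \<open>The chain to be coned is a cycle: the boundary commutes with the operators and two
  consecutive operators compose to zero. In degree 0 the two points have augmentations that cancel.
  Hence the correction term of the cone formula vanishes. The conclusion mentions the preceding
  chain as well because the induction step applies two operators to it.\<close>

lemma resolution_chain:
  assumes triv: "\<And>q x. q \<le> n \<Longrightarrow> x \<in> topspace X \<Longrightarrow> homotopy_group_trivial X q x"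
    and x0: "x0 \<in> topspace X"
    and T: "continuous_map X X T" and per: "\<And>x. x \<in> topspace X \<Longrightarrow> (T ^^ m) x = x"
    and k: "k \<le> Suc n"
  shows "singular_chain k X (resolution_chain m T X x0 k) \<and>
    (\<forall>j. k = Suc j \<longrightarrow> singular_chain j X (resolution_chain m T X x0 j) \<and>
        chain_boundary k (resolution_chain m T X x0 k) = period_op m T j j (resolution_chain m T X x0 j))"
  using k
proof (induction k)
  case 0
  then show ?case by (simp add: singular_chain_of singular_simplex_const_simplex x0)
next
  case (Suc k)
  let ?w = "resolution_chain m T X x0"
  have IH: "singular_chain k X (?w k)" "\<And>j. k = Suc j \<Longrightarrow> singular_chain j X (?w j)"
    "\<And>j. k = Suc j \<Longrightarrow> chain_boundary k (?w k) = period_op m T j j (?w j)"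
    using Suc by auto
  have triv': "homotopy_group_trivial X q x" if "q \<le> k" "x \<in> topspace X" for q x
    using triv Suc.prems that by auto
  have pw: "singular_chain k X (period_op m T k k (?w k))"
    by (rule singular_chain_period_op[OF T IH(1)])
  have "(if k = 0 then frag_extend (\<lambda>_. frag_of (const_simplex 0 x0)) (period_op m T k k (?w k))
         else cone_chain X x0 (k - 1) (chain_boundary k (period_op m T k k (?w k)))) = 0"
  proof (cases k)
    case 0
    then show ?thesis by (simp add: period_op_def frag_extend_diff)
  next
    case (Suc j)
    have "period_op m T (Suc j) j (period_op m T j j (?w j)) = 0"
      by (rule period_op_period_op[OF T per IH(2)[OF Suc]])
    then show ?thesis
      using IH chain_boundary_period_op[of j X "?w k" m T k] Suc by (simp add: cone_chain_def)
  qed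
  then show ?case
    using singular_chain_cone_chain[OF triv' x0 pw] chain_boundary_cone_chain[OF triv' x0 pw] IH(1) by simp
qed

section \<open>Alternating cochains on lists of labels\<close>

text \<open>The alternating sum over deletions of one entry, in recursive form. The empty list
  counts as a face of a singleton, so the complex is augmented.\<close>

fun list_coboundary :: "('a list \<Rightarrow> int) \<Rightarrow> 'a list \<Rightarrow> int" where
  "list_coboundary g [] = 0"
| "list_coboundary g (x # u) = g u - list_coboundary (\<lambda>v. g (x # v)) u"

lemma list_coboundary_diff:
  "list_coboundary (\<lambda>v. g v - h v) u = list_coboundary g u - list_coboundary h u"
  by (induction u arbitrary: g h) simp_all

lemma list_coboundary_zero: "list_coboundary (\<lambda>v. 0) u = 0"
  by (induction u) simp_all

lemma list_coboundary_add:
  "list_coboundary (\<lambda>v. g v + h v) u = list_coboundary g u + list_coboundary h u"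
  by (induction u arbitrary: g h) simp_all

text \<open>After splitting off the first entry \<open>x\<close>, the terms that delete
  \<open>x\<close> once cancel, leaving the induction hypothesis for
  \<open>\<lambda>v. g (x # v)\<close>.\<close>

lemma list_coboundary_list_coboundary: "list_coboundary (list_coboundary g) u = 0"
proof (induction u arbitrary: g)
  case (Cons x u)
  show ?case
    using Cons.IH[of "\<lambda>v. g (x # v)"] by (simp add: list_coboundary_diff)
qed simp

lemma list_coboundary_map: "list_coboundary g (map f u) = list_coboundary (\<lambda>v. g (map f v)) u"
  by (induction u arbitrary: g) simp_all

lemma list_coboundary_sum:
  "list_coboundary (\<lambda>v. \<Sum>i\<in>I. g i v) u = (\<Sum>i\<in>I. list_coboundary (g i) u)"
  by (induction u arbitrary: g) (simp_all add: sum_subtractf)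

lemma list_coboundary_eq_sum:
  "list_coboundary g u = (\<Sum>j<length u. (-1) ^ j * g (take j u @ drop (Suc j) u))"
proof (induction u arbitrary: g)
  case (Cons x u)
  show ?case
    unfolding list_coboundary.simps Cons.IH length_Cons sum.lessThan_Suc_shift
    by (simp add: sum_negf)
qed simp

lemma list_coboundary_cong:
  assumes "\<And>v. set v \<subseteq> set u \<Longrightarrow> Suc (length v) = length u \<Longrightarrow> [g v = h v] (mod m)"
  shows "[list_coboundary g u = list_coboundary h u] (mod m)"
  unfolding list_coboundary_eq_sum
proof (intro cong_sum cong_mult cong_refl assms)
  fix j assume "j \<in> {..<length u}"
  then show "set (take j u @ drop (Suc j) u) \<subseteq> set u"
    by (auto dest: in_set_takeD in_set_dropD)
  show "Suc (length (take j u @ drop (Suc j) u)) = length u"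
    using \<open>j \<in> _\<close> by auto
qed

section \<open>Alternating cochains\<close>

text \<open>Adjacent transpositions generate all permutations, so this is full antisymmetry.\<close>

definition alternating :: "('a list \<Rightarrow> int) \<Rightarrow> bool" where
  "alternating g \<longleftrightarrow> (\<forall>xs a b ys. g (xs @ a # b # ys) = - g (xs @ b # a # ys))"

lemma alternating_Cons: "alternating g \<Longrightarrow> alternating (\<lambda>v. g (x # v))"
  unfolding alternating_def by (metis append_Cons)

lemma alternating_list_coboundary:
  assumes "alternating g" shows "alternating (list_coboundary g)"
proof -
  have "list_coboundary g (xs @ a # b # ys) = - list_coboundary g (xs @ b # a # ys)" for xs a b ys
    using assms
  proof (induction xs arbitrary: g)
    case Nil
    then have "g (a # b # v) + g (b # a # v) = 0" for v
      unfolding alternating_def by (metis add.left_inverse append_Nil)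
    then have "list_coboundary (\<lambda>v. g (a # b # v)) ys + list_coboundary (\<lambda>v. g (b # a # v)) ys = 0"
      by (simp flip: list_coboundary_add add: list_coboundary_zero)
    then show ?case by simp
  next
    case (Cons x xs)
    have "g (xs @ a # b # ys) = - g (xs @ b # a # ys)"
      using Cons.prems unfolding alternating_def by blast
    then show ?case
      using Cons.IH[OF alternating_Cons[OF Cons.prems, of x]] by simp
  qed
  then show ?thesis unfolding alternating_def by blast
qed

lemma alternating_not_distinct:
  assumes g: "alternating g" and u: "\<not> distinct u"
  shows "g u = 0"
proof -
  have "g (xs @ a # ys @ a # zs) = 0" for xs a ys zs
  proof (induction ys arbitrary: xs)
    case Nil
    show ?case
      using g unfolding alternating_def by (metis append_Nil equal_neg_zero)
  next
    case (Cons y ys)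
    have "g (xs @ a # (y # ys) @ a # zs) = - g (xs @ y # a # ys @ a # zs)"
      using g unfolding alternating_def append_Cons by blast
    then show ?case
      using Cons.IH[of "xs @ [y]"] by simp
  qed
  then show ?thesis
    using not_distinct_decomp[OF u] by auto
qed

text \<open>A label \<open>(j, i)\<close> stands for the vertex \<open>t\<^sup>j\<close> in the \<open>i\<close>-th factor of the join of copies
  of the cyclic group \<open>{0..<m}\<close>; a list of labels is compatible if it spans a simplex there.\<close>

definition shift :: "nat \<Rightarrow> nat \<times> nat \<Rightarrow> nat \<times> nat" where
  "shift m l = (Suc (fst l) mod m, snd l)"

definition compatible :: "nat \<Rightarrow> (nat \<times> nat) set \<Rightarrow> bool" where
  "compatible m S \<longleftrightarrow> (\<forall>a\<in>S. fst a < m) \<and> (\<forall>a\<in>S. \<forall>b\<in>S. snd a = snd b \<longrightarrow> a = b)"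

definition lead :: "(nat \<times> nat) list \<Rightarrow> nat" where
  "lead u = Min {j. (j, Min (snd ` set u)) \<in> set u}"

lemma compatible_subset: "compatible m S \<Longrightarrow> T \<subseteq> S \<Longrightarrow> compatible m T"
  unfolding compatible_def by blast

lemma shift_funpow: "(shift m ^^ k) l = (if k = 0 then l else ((fst l + k) mod m, snd l))"
  by (induction k) (auto simp: shift_def mod_Suc_eq)

lemma map_funpow: "(map (f :: 'a \<Rightarrow> 'a) ^^ k) u = map (f ^^ k) u"
  by (induction k) simp_all

lemma compatible_shift:
  assumes "compatible m (set u)"
  shows "compatible m (set (map (shift m) u))"
proof -
  have "Suc (fst a) mod m < m" if "a \<in> set u" for a
    using assms that by (force simp: compatible_def)
  moreover have "shift m a = shift m b"
    if "a \<in> set u" "b \<in> set u" "snd (shift m a) = snd (shift m b)" for a b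
    using assms that unfolding compatible_def shift_def snd_conv by blast
  moreover have "fst (shift m a) = Suc (fst a) mod m" for a
    by (simp add: shift_def)
  ultimately show ?thesis
    unfolding compatible_def set_map ball_simps by metis
qed

lemma compatible_shift_funpow:
  assumes "compatible m (set u)"
  shows "compatible m (set ((map (shift m) ^^ k) u))"
  by (induction k) (use assms compatible_shift in auto)

lemma shift_funpow_period:
  assumes "compatible m (set u)"
  shows "(map (shift m) ^^ m) u = u"
proof -
  have "(shift m ^^ m) l = l" if "l \<in> set u" for l
    using assms that by (auto simp: compatible_def shift_funpow)
  then show ?thesis by (simp add: map_funpow map_idI)
qed

lemma lead_eq:
  assumes "compatible m (set u)" "(j, Min (snd ` set u)) \<in> set u"
  shows "lead u = j"
proof -
  have "{j. (j, Min (snd ` set u)) \<in> set u} = {j}"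
    using assms by (force simp: compatible_def)
  then show ?thesis by (simp add: lead_def)
qed

lemma lead_witness:
  assumes "compatible m (set u)" "u \<noteq> []"
  shows "(lead u, Min (snd ` set u)) \<in> set u"
proof -
  have "Min (snd ` set u) \<in> snd ` set u"
    using assms by (intro Min_in) auto
  then obtain j where "(j, Min (snd ` set u)) \<in> set u" by force
  then show ?thesis using lead_eq[OF assms(1)] by metis
qed

lemma lead_less: "compatible m (set u) \<Longrightarrow> u \<noteq> [] \<Longrightarrow> lead u < m"
  using lead_witness by (fastforce simp: compatible_def)

lemma lead_shift:
  assumes "compatible m (set u)" "u \<noteq> []"
  shows "lead (map (shift m) u) = Suc (lead u) mod m"
proof (rule lead_eq)
  show "compatible m (set (map (shift m) u))"
    using assms by (simp add: compatible_shift del: set_map)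
  have "snd ` set (map (shift m) u) = snd ` set u"
    by (force simp: shift_def image_image)
  then show "(Suc (lead u) mod m, Min (snd ` set (map (shift m) u))) \<in> set (map (shift m) u)"
    using lead_witness[OF assms] by (force simp: shift_def)
qed

lemma lead_shift_funpow:
  assumes "compatible m (set u)" "u \<noteq> []"
  shows "lead ((map (shift m) ^^ k) u) = (lead u + k) mod m"
proof (induction k)
  case (Suc k)
  have "(map (shift m) ^^ k) u \<noteq> []" using assms by (simp add: map_funpow)
  then show ?case
    using Suc lead_shift[OF compatible_shift_funpow[OF assms(1), of k]] by (simp add: mod_Suc_eq)
qed (use lead_less[OF assms] in simp)

text \<open>A solution \<open>g\<close> of \<open>g (t u) - g u = a u\<close> for even \<open>k\<close> and of \<open>\<Sum>l<m. g (t\<^sup>l u) = a u\<close> for odd \<open>k\<close>.\<close>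

definition equivariant_primitive ::
    "nat \<Rightarrow> nat \<Rightarrow> ((nat \<times> nat) list \<Rightarrow> int) \<Rightarrow> (nat \<times> nat) list \<Rightarrow> int" where
  "equivariant_primitive m k a u =
     (if even k then \<Sum>l<lead u. a ((map (shift m) ^^ (m - lead u + l)) u)
      else if lead u = 0 then a u else 0)"

lemma equivariant_primitive_even:
  assumes u: "compatible m (set u)" "u \<noteq> []" and "even k"
    and a: "[(\<Sum>l<m. a ((map (shift m) ^^ l) u)) = 0] (mod int m)"
  shows "[equivariant_primitive m k a (map (shift m) u) - equivariant_primitive m k a u = a u] (mod int m)"
proof -
  let ?g = "equivariant_primitive m k a" and ?s = "map (shift m)" and ?r = "lead u"
  have r: "?r < m" by (rule lead_less[OF u])
  have gu: "?g u = (\<Sum>l<?r. a ((?s ^^ (m - ?r + l)) u))"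
    using \<open>even k\<close> by (simp add: equivariant_primitive_def)
  show ?thesis
  proof (cases "Suc ?r = m")
    case True
    then have gsu: "?g (?s u) = 0"
      using \<open>even k\<close> lead_shift[OF u] by (simp add: equivariant_primitive_def)
    have "(\<Sum>l<m. a ((?s ^^ l) u)) = a u + (\<Sum>l<?r. a ((?s ^^ Suc l) u))"
      using sum.lessThan_Suc_shift[of "\<lambda>l. a ((?s ^^ l) u)" ?r] True by simp
    also have "(\<Sum>l<?r. a ((?s ^^ Suc l) u)) = ?g u"
    proof -
      have "m - ?r + l = Suc l" for l using True by linarith
      then show ?thesis unfolding gu by simp
    qed
    finally have "?g (?s u) - ?g u = a u - (\<Sum>l<m. a ((?s ^^ l) u))"
      using gsu by simp
    then show ?thesis
      using cong_diff[OF cong_refl a, of "a u"] by simp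
  next
    case False
    then have r1: "Suc ?r < m" using r by simp
    have "?g (?s u) = (\<Sum>l<Suc ?r. a ((?s ^^ (m - Suc ?r + l)) (?s u)))"
      using \<open>even k\<close> lead_shift[OF u] r1 by (simp add: equivariant_primitive_def)
    also have "\<dots> = (\<Sum>l<Suc ?r. a ((?s ^^ (m - ?r + l)) u))"
    proof (rule sum.cong)
      fix l
      have "m - ?r + l = Suc (m - Suc ?r + l)" using r1 by simp
      then have "(?s ^^ (m - Suc ?r + l)) (?s u) = (?s ^^ (m - ?r + l)) u"
        by (simp only: funpow_Suc_right o_apply)
      then show "a ((?s ^^ (m - Suc ?r + l)) (?s u)) = a ((?s ^^ (m - ?r + l)) u)" by simp
    qed simp
    also have "\<dots> = ?g u + a u"
      using r shift_funpow_period[OF u(1)] by (simp add: gu)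
    finally show ?thesis by simp
  qed
qed

lemma equivariant_primitive_odd:
  assumes u: "compatible m (set u)" "u \<noteq> []" and "odd k"
    and a: "\<And>v. compatible m (set v) \<Longrightarrow> length v = length u \<Longrightarrow> [a (map (shift m) v) = a v] (mod int m)"
  shows "[(\<Sum>l<m. equivariant_primitive m k a ((map (shift m) ^^ l) u)) = a u] (mod int m)"
proof -
  let ?s = "map (shift m)" and ?r = "lead u"
  define l0 where "l0 = (m - ?r) mod m"
  have r: "?r < m" by (rule lead_less[OF u])
  have l0: "l0 < m" using r by (simp add: l0_def)
  have *: "(?r + l) mod m = 0 \<longleftrightarrow> l = l0" if "l < m" for l
  proof -
    have "(?r + l) mod m = (if ?r + l < m then ?r + l else ?r + l - m)"
      using r that by (simp add: mod_if)
    then show ?thesis using r that by (auto simp: l0_def mod_if)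
  qed
  have inv: "[a ((?s ^^ l) u) = a u] (mod int m)" for l
  proof (induction l)
    case (Suc l)
    have "[a (?s ((?s ^^ l) u)) = a ((?s ^^ l) u)] (mod int m)"
      using compatible_shift_funpow[OF u(1), of l] by (intro a) (simp_all add: map_funpow)
    then show ?case using Suc cong_trans by auto
  qed simp
  have "(\<Sum>l<m. equivariant_primitive m k a ((?s ^^ l) u))
      = (\<Sum>l<m. if l = l0 then a ((?s ^^ l) u) else 0)"
    using \<open>odd k\<close> by (intro sum.cong) (simp_all add: equivariant_primitive_def lead_shift_funpow[OF u] *)
  also have "\<dots> = a ((?s ^^ l0) u)"
    using l0 by simp
  finally show ?thesis using inv by simp
qed

primrec obstruction_cochain :: "nat \<Rightarrow> nat \<Rightarrow> (nat \<times> nat) list \<Rightarrow> int" where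
  "obstruction_cochain m 0 = list_coboundary (\<lambda>v. if v = [] then 1 else 0)"
| "obstruction_cochain m (Suc k) =
     list_coboundary (equivariant_primitive m k (obstruction_cochain m k))"

lemma list_coboundary_obstruction_cochain: "list_coboundary (obstruction_cochain m k) u = 0"
  by (cases k) (simp_all add: list_coboundary_list_coboundary)

lemma obstruction_cochain_periodicity:
  assumes "compatible m (set u)" "length u = Suc k"
  shows "if even k then [(\<Sum>l<m. obstruction_cochain m k ((map (shift m) ^^ l) u)) = 0] (mod int m)
         else [obstruction_cochain m k (map (shift m) u) = obstruction_cochain m k u] (mod int m)"
  using assms
proof (induction k arbitrary: u)
  case 0
  have "obstruction_cochain m 0 ((map (shift m) ^^ l) u) = 1" for l
    using 0 by (auto simp: map_funpow length_Suc_conv)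
  then show ?case by (simp add: cong_0_iff)
next
  case (Suc k)
  let ?a = "obstruction_cochain m k" and ?s = "map (shift m)"
  let ?g = "equivariant_primitive m k ?a"
  have sub: "compatible m (set v)" "length v = Suc k" "v \<noteq> []"
    if "set v \<subseteq> set u" "Suc (length v) = length u" for v
    using that Suc.prems compatible_subset by auto
  show ?case
  proof (cases "even k")
    case True
    have "[list_coboundary (\<lambda>v. ?g (?s v) - ?g v) u = list_coboundary ?a u] (mod int m)"
    proof (rule list_coboundary_cong)
      fix v assume v: "set v \<subseteq> set u" "Suc (length v) = length u"
      show "[?g (?s v) - ?g v = ?a v] (mod int m)"
        using equivariant_primitive_even[OF sub(1)[OF v] sub(3)[OF v] True] Suc.IH[OF sub(1,2)[OF v]] True
        by simp
    qed
    then have "[list_coboundary ?g (?s u) - list_coboundary ?g u = 0] (mod int m)"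
      by (simp add: list_coboundary_diff list_coboundary_map list_coboundary_obstruction_cochain)
    then show ?thesis using True by (simp add: cong_diff_iff_cong_0)
  next
    case False
    have map_pow: "list_coboundary ?g ((?s ^^ l) u) = list_coboundary (\<lambda>v. ?g ((?s ^^ l) v)) u" for l
      by (simp add: map_funpow list_coboundary_map)
    have "[list_coboundary (\<lambda>v. \<Sum>l<m. ?g ((?s ^^ l) v)) u = list_coboundary ?a u] (mod int m)"
    proof (rule list_coboundary_cong)
      fix v assume v: "set v \<subseteq> set u" "Suc (length v) = length u"
      show "[(\<Sum>l<m. ?g ((?s ^^ l) v)) = ?a v] (mod int m)"
        using equivariant_primitive_odd[OF sub(1)[OF v] sub(3)[OF v] False] Suc.IH sub(2)[OF v] False
        by simp
    qed
    then show ?thesis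
      using False by (simp add: list_coboundary_sum map_pow list_coboundary_obstruction_cochain)
  qed
qed

lemma obstruction_cochain_step:
  assumes "compatible m (set u)" "length u = Suc k"
  defines "g \<equiv> equivariant_primitive m k (obstruction_cochain m k)"
  shows "[(if even k then g (map (shift m) u) - g u else \<Sum>l<m. g ((map (shift m) ^^ l) u))
          = obstruction_cochain m k u] (mod int m)"
proof (cases "even k")
  case True
  then show ?thesis
    using assms obstruction_cochain_periodicity[OF assms(1,2)]
    by (auto intro!: equivariant_primitive_even)
next
  case False
  have "[obstruction_cochain m k (map (shift m) v) = obstruction_cochain m k v] (mod int m)"
    if "compatible m (set v)" "length v = length u" for v
    using obstruction_cochain_periodicity[of m v k] that assms False by simp
  then show ?thesis
    using False assms by (auto intro!: equivariant_primitive_odd)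
qed

lemma alternating_equivariant_primitive:
  assumes "alternating a" shows "alternating (equivariant_primitive m k a)"
proof -
  have lead: "lead (xs @ a # b # ys) = lead (xs @ b # a # ys)" for xs ys and a b :: "nat \<times> nat"
    by (simp add: lead_def insert_commute)
  have swap: "a (map f (xs @ x # y # ys)) = - a (map f (xs @ y # x # ys))" for f and x y :: "nat \<times> nat" and xs ys
    using assms unfolding alternating_def map_append list.map by blast
  have "equivariant_primitive m k a (xs @ x # y # ys) = - equivariant_primitive m k a (xs @ y # x # ys)"
    for xs x y ys
    unfolding equivariant_primitive_def lead[of xs x y ys] map_funpow swap[of _ xs x y ys]
    using swap[of id xs x y ys] by (simp add: sum_negf)
  then show ?thesis unfolding alternating_def by blast
qed

lemma alternating_obstruction_cochain: "alternating (obstruction_cochain m k)"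
proof (induction k)
  case 0
  have "alternating (\<lambda>v :: (nat \<times> nat) list. if v = [] then 1 else 0)"
    by (simp add: alternating_def)
  then show ?case by (simp add: alternating_list_coboundary)
next
  case (Suc k)
  then show ?case
    by (simp add: alternating_list_coboundary alternating_equivariant_primitive)
qed

section \<open>Equivariant labellings of highly connected spaces\<close>

lemma singular_subdivision_power_add:
  "(singular_subdivision p ^^ M) (a + b) = (singular_subdivision p ^^ M) a + (singular_subdivision p ^^ M) b"
  by (induction M) (auto simp: singular_subdivision_add)

lemma singular_subdivision_power_sum:
  "finite I \<Longrightarrow> (singular_subdivision p ^^ M) (\<Sum>i\<in>I. f i) = (\<Sum>i\<in>I. (singular_subdivision p ^^ M) (f i))"
  by (induction I rule: finite_induct) (auto simp: singular_subdivision_power_add)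

lemma singular_chain_singular_subdivision_power:
  "singular_chain p X c \<Longrightarrow> singular_chain p X ((singular_subdivision p ^^ M) c)"
  by (induction M) (auto simp: singular_chain_singular_subdivision)

lemma chain_boundary_singular_subdivision_power:
  "singular_chain (Suc p) X c \<Longrightarrow>
   chain_boundary (Suc p) ((singular_subdivision (Suc p) ^^ M) c) = (singular_subdivision p ^^ M) (chain_boundary (Suc p) c)"
  by (induction M)
     (auto simp: chain_boundary_singular_subdivision[OF singular_chain_singular_subdivision_power])

lemma naturality_singular_subdivision_power:
  "singular_chain p X c \<Longrightarrow>
   (singular_subdivision p ^^ M) (chain_map p g c) = chain_map p g ((singular_subdivision p ^^ M) c)"
  by (induction M)
     (auto simp: naturality_singular_subdivision[OF singular_chain_singular_subdivision_power])

lemma singular_subdivision_power_period_op: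
  "singular_chain p X c \<Longrightarrow>
   (singular_subdivision p ^^ M) (period_op m T k p c) = period_op m T k p ((singular_subdivision p ^^ M) c)"
  by (simp add: period_op_def singular_subdivision_power_diff singular_subdivision_power_sum
      naturality_singular_subdivision_power)

definition pairing :: "('b \<Rightarrow> int) \<Rightarrow> ('b \<Rightarrow>\<^sub>0 int) \<Rightarrow> int" where
  "pairing h c = (\<Sum>s\<in>Poly_Mapping.keys c. Poly_Mapping.lookup c s * h s)"

lemma pairing_eq_lookup:
  "pairing h c = Poly_Mapping.lookup (frag_extend (\<lambda>s. frag_cmul (h s) (frag_of ())) c) ()"
  by (simp add: pairing_def frag_extend_def lookup_sum)

lemma pairing_diff: "pairing h (a - b) = pairing h a - pairing h b"
  by (simp add: pairing_eq_lookup frag_extend_diff lookup_minus)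

lemma pairing_cmul: "pairing h (frag_cmul k a) = k * pairing h a"
  by (simp add: pairing_eq_lookup frag_extend_cmul)

lemma pairing_sum: "finite I \<Longrightarrow> pairing h (\<Sum>i\<in>I. f i) = (\<Sum>i\<in>I. pairing h (f i))"
  by (simp add: pairing_eq_lookup frag_extend_sum lookup_sum)

lemma pairing_frag_of: "pairing h (frag_of s) = h s"
  by (simp add: pairing_def)

lemma pairing_frag_extend: "pairing h (frag_extend f c) = pairing (\<lambda>s. pairing h (f s)) c"
  by (simp add: frag_extend_def pairing_sum pairing_cmul) (simp add: pairing_def)

lemma pairing_chain_map: "pairing h (chain_map p g c) = pairing (\<lambda>s. h (simplex_map p g s)) c"
  by (simp add: chain_map_def pairing_frag_extend pairing_frag_of)

lemma pairing_chain_boundary: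
  "pairing h (chain_boundary (Suc p) c) =
   pairing (\<lambda>s. \<Sum>j\<le>Suc p. (-1) ^ j * h (singular_face (Suc p) j s)) c"
  by (simp add: chain_boundary_def pairing_frag_extend pairing_sum pairing_cmul pairing_frag_of
      del: sum.atMost_Suc)

lemma pairing_cong:
  "(\<And>s. s \<in> Poly_Mapping.keys c \<Longrightarrow> [h s = h' s] (mod m)) \<Longrightarrow> [pairing h c = pairing h' c] (mod m)"
  unfolding pairing_def by (intro cong_sum cong_mult cong_refl)

lemma pairing_fun_diff: "pairing (\<lambda>s. h s - h' s) c = pairing h c - pairing h' c"
  by (simp add: pairing_def algebra_simps sum_subtractf)

lemma pairing_fun_sum: "pairing (\<lambda>s. \<Sum>i\<in>I. h i s) c = (\<Sum>i\<in>I. pairing (h i) c)"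
  unfolding pairing_def by (simp add: sum_distrib_left) (rule sum.swap)

definition vertex_labels :: "nat \<Rightarrow> ('a \<Rightarrow> 'l) \<Rightarrow> ((nat \<Rightarrow> real) \<Rightarrow> 'a) \<Rightarrow> 'l list" where
  "vertex_labels p lam s = map (\<lambda>i. lam (simplicial_vertex i s)) [0..<Suc p]"

lemma length_vertex_labels [simp]: "length (vertex_labels p lam s) = Suc p"
  by (simp add: vertex_labels_def)

lemma vertex_labels_singular_face:
  assumes "j \<le> Suc p"
  shows "vertex_labels p lam (singular_face (Suc p) j s) =
    take j (vertex_labels (Suc p) lam s) @ drop (Suc j) (vertex_labels (Suc p) lam s)"
proof (rule nth_equalityI)
  fix i assume "i < length (vertex_labels p lam (singular_face (Suc p) j s))"
  then have i: "i \<le> p" by simp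
  have "simplical_face j (\<lambda>l. if l = i then 1 else 0 :: real)
      = (\<lambda>l. if l = (if i < j then i else Suc i) then 1 else 0)"
    by (auto simp: simplical_face_def fun_eq_iff)
  then have "simplicial_vertex i (singular_face (Suc p) j s) = simplicial_vertex (if i < j then i else Suc i) s"
    using i by (simp add: simplicial_vertex_def singular_face_def)
  then show "vertex_labels p lam (singular_face (Suc p) j s) ! i =
     (take j (vertex_labels (Suc p) lam s) @ drop (Suc j) (vertex_labels (Suc p) lam s)) ! i"
    using i assms by (auto simp: vertex_labels_def nth_append simp del: upt_Suc)
qed (use assms in auto)

lemma simplicial_vertex_in_topspace:
  assumes "singular_simplex p X s" "i \<le> p"
  shows "simplicial_vertex i s \<in> topspace X"
  using assms unfolding singular_simplex_def simplicial_vertex_def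
  by (auto simp: continuous_map_def Pi_iff)

lemma vertex_labels_simplex_map:
  assumes "singular_simplex p X s" and "\<And>x. x \<in> topspace X \<Longrightarrow> lam (f x) = h (lam x)"
  shows "vertex_labels p lam (simplex_map p f s) = map h (vertex_labels p lam s)"
proof -
  have "simplicial_vertex i (simplex_map p f s) = f (simplicial_vertex i s)" if "i \<le> p" for i
    using that by (simp add: simplicial_vertex_def simplex_map_def)
  then show ?thesis
    using assms(2)[OF simplicial_vertex_in_topspace[OF assms(1)]]
    by (simp add: vertex_labels_def del: upt_Suc)
qed

lemma pairing_list_coboundary:
  "pairing (\<lambda>s. g (vertex_labels p lam s)) (chain_boundary (Suc p) c) =
   pairing (\<lambda>s. list_coboundary g (vertex_labels (Suc p) lam s)) c"
proof -
  have "(\<Sum>j\<le>Suc p. (-1) ^ j * g (vertex_labels p lam (singular_face (Suc p) j s)))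
      = list_coboundary g (vertex_labels (Suc p) lam s)" for s
    unfolding list_coboundary_eq_sum length_vertex_labels lessThan_Suc_atMost
    by (rule sum.cong) (simp_all add: vertex_labels_singular_face)
  then show ?thesis by (simp add: pairing_chain_boundary del: sum.atMost_Suc)
qed

lemma alternating_compatible_zero:
  assumes "alternating g" "compatible m (set u)" "snd ` set u \<subseteq> {..n}" "length u = Suc (Suc n)"
  shows "g u = 0"
proof (rule alternating_not_distinct[OF assms(1)])
  show "\<not> distinct u"
  proof
    assume "distinct u"
    then have "card (set u) = Suc (Suc n)" using assms by (simp add: distinct_card)
    moreover have "inj_on snd (set u)"
      using assms(2) unfolding compatible_def inj_on_def by blast
    then have "card (set u) \<le> card {..n}"
      using assms(3) by (intro card_inj_on_le) auto
    ultimately show False by simp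
  qed
qed

lemma no_equivariant_small_labelling:
  fixes T :: "'a \<Rightarrow> 'a" and lam :: "'a \<Rightarrow> nat \<times> nat"
  assumes m: "m \<ge> 2"
    and triv: "\<And>q x. q \<le> n \<Longrightarrow> x \<in> topspace X \<Longrightarrow> homotopy_group_trivial X q x"
    and x0: "x0 \<in> topspace X"
    and T: "continuous_map X X T" and per: "\<And>x. x \<in> topspace X \<Longrightarrow> (T ^^ m) x = x"
    and lam_shift: "\<And>x. x \<in> topspace X \<Longrightarrow> lam (T x) = shift m (lam x)"
    and lam_snd: "\<And>x. x \<in> topspace X \<Longrightarrow> snd (lam x) \<le> n"
    and cover: "topspace X \<subseteq> \<Union>\<C>" "\<And>V. V \<in> \<C> \<Longrightarrow> openin X V"
    and small: "\<And>V. V \<in> \<C> \<Longrightarrow> compatible m (lam ` V)"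
  shows False
proof -
  define w where "w = resolution_chain m T X x0"
  have w: "singular_chain k X (w k)" if "k \<le> Suc n" for k
    using resolution_chain[OF triv x0 T per that] by (simp add: w_def)
  have bw: "chain_boundary (Suc k) (w (Suc k)) = period_op m T k k (w k)" if "k \<le> n" for k
    using resolution_chain[OF triv x0 T per, of n "Suc k"] that by (simp add: w_def)
  have "\<exists>M. \<forall>M'\<ge>M. \<forall>s\<in>Poly_Mapping.keys ((singular_subdivision k ^^ M') (w k)). \<exists>V\<in>\<C>. s ` standard_simplex k \<subseteq> V"
    if k: "k \<le> Suc n" for k
  proof -
    obtain M where "\<And>M' s. \<lbrakk>M \<le> M'; s \<in> Poly_Mapping.keys ((singular_subdivision k ^^ M') (w k))\<rbrakk>
        \<Longrightarrow> \<exists>V\<in>\<C>. s \<in> standard_simplex k \<rightarrow> V"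
      using sufficient_iterated_singular_subdivision_exists[of \<C> X k "w k"] cover w[OF k] by blast
    then show ?thesis unfolding image_subset_iff_funcset by blast
  qed
  then obtain N where N: "\<And>k M s. k \<le> Suc n \<Longrightarrow> N k \<le> M \<Longrightarrow>
      s \<in> Poly_Mapping.keys ((singular_subdivision k ^^ M) (w k)) \<Longrightarrow> \<exists>V\<in>\<C>. s ` standard_simplex k \<subseteq> V"
    by metis
  define M where "M = Max (N ` {..Suc n})"
  define v where "v k = (singular_subdivision k ^^ M) (w k)" for k
  have v: "singular_chain k X (v k)" if "k \<le> Suc n" for k
    unfolding v_def using singular_chain_singular_subdivision_power[OF w[OF that]] .
  have bv: "chain_boundary (Suc k) (v (Suc k)) = period_op m T k k (v k)" if "k \<le> n" for k
    unfolding v_def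
    using chain_boundary_singular_subdivision_power[OF w[of "Suc k"]] bw[OF that]
      singular_subdivision_power_period_op[OF w[of k]] that by simp
  have compat: "compatible m (set (vertex_labels k lam s))" "snd ` set (vertex_labels k lam s) \<subseteq> {..n}"
    if k: "k \<le> Suc n" and s: "s \<in> Poly_Mapping.keys (v k)" for k s
  proof -
    have ss: "singular_simplex k X s" using v[OF k] s by (auto simp: singular_chain_def)
    have "N k \<le> M" unfolding M_def using k by (intro Max_ge) auto
    then obtain V where V: "V \<in> \<C>" "s ` standard_simplex k \<subseteq> V"
      using N[OF k] s unfolding v_def by blast
    have "set (vertex_labels k lam s) \<subseteq> lam ` V"
    proof
      fix l assume "l \<in> set (vertex_labels k lam s)"
      then obtain i where i: "i \<le> k" "l = lam (simplicial_vertex i s)"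
        by (auto simp: vertex_labels_def less_Suc_eq_le simp del: upt_Suc)
      have "simplicial_vertex i s \<in> s ` standard_simplex k"
        unfolding simplicial_vertex_def using i(1) by (intro imageI) simp
      then show "l \<in> lam ` V" using i V by blast
    qed
    then show "compatible m (set (vertex_labels k lam s))"
      by (rule compatible_subset[OF small[OF V(1)]])
    show "snd ` set (vertex_labels k lam s) \<subseteq> {..n}"
      using lam_snd[OF simplicial_vertex_in_topspace[OF ss]] by (auto simp: vertex_labels_def less_Suc_eq_le simp del: upt_Suc)
  qed
  define a where "a k s = obstruction_cochain m k (vertex_labels k lam s)" for k s
  have "[pairing (a k) (v k) = 1] (mod int m)" if "k \<le> Suc n" for k
    using that
  proof (induction k)
    case 0
    have "(singular_subdivision 0 ^^ M) (w 0) = w 0"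
      using singular_subdivision_zero[OF w[of 0]] by (induction M) auto
    then have "pairing (a 0) (v 0) = 1"
      by (simp add: v_def w_def pairing_frag_of a_def vertex_labels_def)
    then show ?case by simp
  next
    case (Suc k)
    define g where "g = equivariant_primitive m k (obstruction_cochain m k)"
    let ?L = "vertex_labels k lam"
    have lab_T: "?L (simplex_map k (T ^^ l) s) = (map (shift m) ^^ l) (?L s)"
      if "s \<in> Poly_Mapping.keys (v k)" for l s
    proof -
      have ss: "singular_simplex k X s" using v[of k] that Suc.prems by (auto simp: singular_chain_def)
      have "lam ((T ^^ l) x) = (shift m ^^ l) (lam x)" if "x \<in> topspace X" for x
      proof (induction l)
        case (Suc l)
        have "(T ^^ l) x \<in> topspace X"
          using continuous_map_funpow[OF T, of l] that by (auto simp: continuous_map_def)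
        then show ?case using Suc lam_shift by simp
      qed simp
      then show ?thesis
        using vertex_labels_simplex_map[OF ss, of lam "T ^^ l" "shift m ^^ l"] by (simp add: map_funpow)
    qed
    have "[pairing (\<lambda>s. if even k then g (map (shift m) (?L s)) - g (?L s)
              else \<Sum>l<m. g ((map (shift m) ^^ l) (?L s))) (v k) = pairing (a k) (v k)] (mod int m)"
      unfolding a_def g_def
      using compat(1)[of k] Suc.prems by (intro pairing_cong obstruction_cochain_step) auto
    also have "pairing (\<lambda>s. if even k then g (map (shift m) (?L s)) - g (?L s)
              else \<Sum>l<m. g ((map (shift m) ^^ l) (?L s))) (v k)
        = pairing (\<lambda>s. g (?L s)) (period_op m T k k (v k))"
    proof (cases "even k")
      case True
      have "pairing (\<lambda>s. g (map (shift m) (?L s))) (v k) = pairing (\<lambda>s. g (?L (simplex_map k T s))) (v k)"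
        using lab_T[of _ 1] by (simp add: pairing_def)
      then show ?thesis
        using True by (simp add: period_op_def pairing_diff pairing_chain_map pairing_fun_diff)
    next
      case False
      have "pairing (\<lambda>s. g ((map (shift m) ^^ l) (?L s))) (v k) = pairing (\<lambda>s. g (?L (simplex_map k (T ^^ l) s))) (v k)" for l
        using lab_T[of _ l] by (simp add: pairing_def)
      then show ?thesis
        using False by (simp add: period_op_def pairing_sum pairing_chain_map pairing_fun_sum)
    qed
    also have "\<dots> = pairing (\<lambda>s. g (?L s)) (chain_boundary (Suc k) (v (Suc k)))"
      using bv Suc.prems by simp
    also have "\<dots> = pairing (a (Suc k)) (v (Suc k))"
      by (simp add: pairing_list_coboundary a_def[abs_def] g_def)
    finally show ?case using Suc.IH Suc.prems cong_trans by auto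
  qed
  moreover have "pairing (a (Suc n)) (v (Suc n)) = 0"
    unfolding pairing_def a_def
  proof (intro sum.neutral ballI)
    fix s assume s: "s \<in> Poly_Mapping.keys (v (Suc n))"
    have "obstruction_cochain m (Suc n) (vertex_labels (Suc n) lam s) = 0"
      using alternating_compatible_zero[OF alternating_obstruction_cochain compat(1)[OF _ s] compat(2)[OF _ s]]
      by (simp del: obstruction_cochain.simps)
    then show "poly_mapping.lookup (v (Suc n)) s * obstruction_cochain m (Suc n) (vertex_labels (Suc n) lam s) = 0"
      by simp
  qed
  ultimately have "[0 = 1] (mod int m)" by (metis order_refl)
  then show False using m by (simp add: cong_def)
qed

lemma no_equivariant_map_to_join:
  fixes T :: "'a \<Rightarrow> 'a" and phi :: "nat \<times> nat \<Rightarrow> 'a \<Rightarrow> real"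
  assumes m: "m \<ge> 2"
    and triv: "\<And>q x. q \<le> n \<Longrightarrow> x \<in> topspace X \<Longrightarrow> homotopy_group_trivial X q x"
    and X: "topspace X \<noteq> {}"
    and T: "continuous_map X X T" and per: "\<And>x. x \<in> topspace X \<Longrightarrow> (T ^^ m) x = x"
    and phi: "\<And>l. continuous_map X euclideanreal (phi l)"
    and phi_sum: "\<And>x. x \<in> topspace X \<Longrightarrow> (\<Sum>l\<in>{..<m} \<times> {..n}. phi l x) = 1"
    and phi_excl: "\<And>x j j' i. x \<in> topspace X \<Longrightarrow> j < m \<Longrightarrow> j' < m \<Longrightarrow> phi (j, i) x > 0 \<Longrightarrow> phi (j', i) x > 0 \<Longrightarrow> j = j'"
    and phi_shift: "\<And>x l. x \<in> topspace X \<Longrightarrow> fst l < m \<Longrightarrow> phi (shift m l) (T x) = phi l x"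
  shows False
proof -
  define L where "L = {..<m} \<times> {..n}"
  define \<epsilon> where "\<epsilon> = 1 / real (card L)"
  have cardL: "card L > 0" using m by (simp add: L_def)
  have \<epsilon>: "\<epsilon> > 0" using cardL by (simp add: \<epsilon>_def)
  define big where "big x j i \<longleftrightarrow> j < m \<and> \<epsilon> \<le> phi (j, i) x" for x j i
  define col where "col x = (LEAST i. \<exists>j. big x j i)" for x
  define lam where "lam x = (THE j. big x j (col x), col x)" for x
  have uniq: "j = j'" if "x \<in> topspace X" "big x j i" "big x j' i" for x j j' i
    using phi_excl[OF that(1)] that(2,3) \<epsilon> unfolding big_def by (meson less_le_trans)
  have ex: "\<exists>j. \<exists>i\<le>n. big x j i" if x: "x \<in> topspace X" for x
  proof (rule ccontr)
    assume neg: "\<not> ?thesis"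
    have "(\<Sum>l\<in>L. phi l x) < (\<Sum>l\<in>L. \<epsilon>)"
    proof (rule sum_strict_mono)
      show "finite L" "L \<noteq> {}" using cardL by (auto simp: card_gt_0_iff)
      fix l assume "l \<in> L"
      then show "phi l x < \<epsilon>" using neg by (force simp: L_def big_def)
    qed
    also have "\<dots> = 1" using cardL by (simp add: \<epsilon>_def)
    finally show False using phi_sum[OF x] by (simp add: L_def)
  qed
  have lam: "big x (fst (lam x)) (snd (lam x))" "snd (lam x) \<le> n" if x: "x \<in> topspace X" for x
  proof -
    obtain j i where ji: "i \<le> n" "big x j i" using ex[OF x] by blast
    then have "\<exists>j. big x j (col x)"
      unfolding col_def by (intro LeastI_ex[of "\<lambda>i. \<exists>j. big x j i"]) blast
    then have "\<exists>!j. big x j (col x)" using uniq[OF x] by blast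
    then show "big x (fst (lam x)) (snd (lam x))"
      unfolding lam_def fst_conv snd_conv by (rule theI')
    have "col x \<le> i" unfolding col_def using ji by (intro Least_le) blast
    then show "snd (lam x) \<le> n" using ji by (simp add: lam_def)
  qed
  have lam_eq: "lam x = (j, col x)" if "x \<in> topspace X" "big x j (col x)" for x j
    unfolding lam_def using uniq[OF that(1)] that(2) by blast
  have TX: "T x \<in> topspace X" if "x \<in> topspace X" for x
    using T that by (auto simp: continuous_map_def)
  have big_T: "big (T x) (Suc j mod m) i" if "x \<in> topspace X" "big x j i" for x j i
    using that phi_shift[of x "(j, i)"] m by (simp add: big_def shift_def)
  have big_T': "\<exists>j. big x j i" if x: "x \<in> topspace X" and "big (T x) j i" for x j i
  proof -
    have jm: "j < m" using that by (simp add: big_def)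
    have "Suc ((j + (m - 1)) mod m) mod m = j"
      using jm m by (simp add: mod_Suc_eq)
    then have "phi (j, i) (T x) = phi ((j + (m - 1)) mod m, i) x"
      using phi_shift[OF x, of "((j + (m - 1)) mod m, i)"] jm m by (simp add: shift_def)
    then show ?thesis using that(2) jm by (auto simp: big_def intro!: exI[of _ "(j + (m - 1)) mod m"])
  qed
  have lam_shift: "lam (T x) = shift m (lam x)" if x: "x \<in> topspace X" for x
  proof -
    have "(\<exists>j. big (T x) j i) \<longleftrightarrow> (\<exists>j. big x j i)" for i
      using big_T[OF x] big_T'[OF x] by blast
    then have col: "col (T x) = col x" by (simp add: col_def)
    have "snd (lam x) = col x" by (simp add: lam_def)
    then show ?thesis
      using lam_eq[OF TX[OF x]] big_T[OF x lam(1)[OF x]] col by (simp add: shift_def)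
  qed
  define V where "V z = {x \<in> topspace X. \<forall>l\<in>L. \<bar>phi l x - phi l z\<bar> < \<epsilon> / 2}" for z
  have V_open: "openin X (V z)" for z
  proof -
    have "V z = topspace X \<inter> (\<Inter>l\<in>L. {x \<in> topspace X. phi l x \<in> ball (phi l z) (\<epsilon> / 2)})"
      by (auto simp: V_def dist_real_def abs_minus_commute)
    also have "openin X \<dots>"
    proof (rule openin_Int_Inter)
      show "finite ((\<lambda>l. {x \<in> topspace X. phi l x \<in> ball (phi l z) (\<epsilon> / 2)}) ` L)"
        by (simp add: L_def)
      show "openin X U" if "U \<in> (\<lambda>l. {x \<in> topspace X. phi l x \<in> ball (phi l z) (\<epsilon> / 2)}) ` L" for U
      proof -
        obtain l where "U = {x \<in> topspace X. phi l x \<in> ball (phi l z) (\<epsilon> / 2)}" using \<open>U \<in> _\<close> by blast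
        moreover have "openin euclideanreal (ball (phi l z) (\<epsilon> / 2))" by simp
        ultimately show ?thesis using openin_continuous_map_preimage[OF phi] by blast
      qed
    qed simp
    finally show ?thesis .
  qed
  have V_compat: "compatible m (lam ` V z)" for z
  proof -
    have "fst (lam x) = fst (lam y)" if xy: "x \<in> V z" "y \<in> V z" "snd (lam x) = snd (lam y)" for x y
    proof -
      have X: "x \<in> topspace X" "y \<in> topspace X" using xy by (auto simp: V_def)
      have b: "big x (fst (lam x)) (snd (lam x))" "big y (fst (lam y)) (snd (lam x))"
        using lam(1)[OF X(1)] lam(1)[OF X(2)] xy(3) by simp_all
      have "lam x \<in> L"
        using b(1) lam(2)[OF X(1)] by (cases "lam x") (simp add: L_def big_def)
      then have "\<bar>phi (lam x) x - phi (lam x) z\<bar> < \<epsilon> / 2" "\<bar>phi (lam x) y - phi (lam x) z\<bar> < \<epsilon> / 2"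
        using xy by (auto simp: V_def)
      moreover have "phi (lam x) x \<ge> \<epsilon>" using b(1) by (simp add: big_def)
      ultimately have "phi (lam x) y > 0" by linarith
      moreover have "phi (fst (lam y), snd (lam x)) y > 0" using b(2) \<epsilon> by (simp add: big_def)
      ultimately show ?thesis
        using phi_excl[OF X(2), of "fst (lam x)" "fst (lam y)" "snd (lam x)"] b by (simp add: big_def)
    qed
    moreover have "fst (lam x) < m" if "x \<in> V z" for x
      using lam(1)[of x] that by (simp add: V_def big_def)
    ultimately show ?thesis
      unfolding compatible_def ball_simps by (metis prod_eq_iff)
  qed
  obtain x0 where "x0 \<in> topspace X" using X by blast
  have "topspace X \<subseteq> \<Union> (V ` topspace X)"
    using \<epsilon> by (auto simp: V_def)
  then show False
    using no_equivariant_small_labelling[of m n X x0 T lam "V ` topspace X"]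
      m triv \<open>x0 \<in> topspace X\<close> T per lam_shift lam(2) V_open V_compat by blast
qed

section \<open>Realizations of posets with a group action\<close>

lemma openin_geom_real:
  "openin (geom_real P R) U \<longleftrightarrow> U \<subseteq> realization P R \<and>
     (\<forall>\<sigma>. is_finite_chain P R \<sigma> \<longrightarrow>
       openin (subtopology (powertop_real UNIV) (closed_simplex P R \<sigma>)) (U \<inter> closed_simplex P R \<sigma>))"
proof -
  let ?op = "\<lambda>U. U \<subseteq> realization P R \<and> (\<forall>\<sigma>. is_finite_chain P R \<sigma> \<longrightarrow>
       openin (subtopology (powertop_real UNIV) (closed_simplex P R \<sigma>)) (U \<inter> closed_simplex P R \<sigma>))"
  have "istopology ?op"
    unfolding istopology_def
  proof (intro conjI allI impI)
    fix S T assume "?op S" "?op T"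
    then show "S \<inter> T \<subseteq> realization P R" by blast
    fix \<sigma> assume "is_finite_chain P R \<sigma>"
    then have "openin (subtopology (powertop_real UNIV) (closed_simplex P R \<sigma>))
        ((S \<inter> closed_simplex P R \<sigma>) \<inter> (T \<inter> closed_simplex P R \<sigma>))"
      using \<open>?op S\<close> \<open>?op T\<close> by (blast intro: openin_Int[of _ "S \<inter> _" "T \<inter> _"])
    moreover have "(S \<inter> closed_simplex P R \<sigma>) \<inter> (T \<inter> closed_simplex P R \<sigma>) = (S \<inter> T) \<inter> closed_simplex P R \<sigma>"
      by blast
    ultimately show "openin (subtopology (powertop_real UNIV) (closed_simplex P R \<sigma>)) (S \<inter> T \<inter> closed_simplex P R \<sigma>)"
      by simp
  next
    fix \<K> assume K: "\<forall>K\<in>\<K>. ?op K"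
    then show "\<Union>\<K> \<subseteq> realization P R" by blast
    fix \<sigma> assume "is_finite_chain P R \<sigma>"
    then have "openin (subtopology (powertop_real UNIV) (closed_simplex P R \<sigma>))
        (\<Union>K\<in>\<K>. K \<inter> closed_simplex P R \<sigma>)"
      using K by (intro openin_Union) blast
    then show "openin (subtopology (powertop_real UNIV) (closed_simplex P R \<sigma>)) (\<Union>\<K> \<inter> closed_simplex P R \<sigma>)"
      by (simp add: Int_commute Int_Union)
  qed
  then show ?thesis
    unfolding geom_real_def by (simp add: topology_inverse')
qed

lemma topspace_geom_real: "topspace (geom_real P R) = realization P R"
proof -
  have "openin (geom_real P R) (realization P R)"
  proof -
    have "realization P R \<inter> closed_simplex P R \<sigma> = closed_simplex P R \<sigma>" for \<sigma>
      by (auto simp: closed_simplex_def)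
    moreover have "openin (subtopology (powertop_real UNIV) (closed_simplex P R \<sigma>)) (closed_simplex P R \<sigma>)" for \<sigma>
      using openin_topspace[of "subtopology (powertop_real UNIV) (closed_simplex P R \<sigma>)"] by simp
    ultimately show ?thesis
      unfolding openin_geom_real by simp
  qed
  moreover have "topspace (geom_real P R) \<subseteq> realization P R"
    using openin_geom_real[of P R "topspace (geom_real P R)"] by simp
  ultimately show ?thesis by (meson openin_subset subset_antisym)
qed

lemma support_finite_chain:
  "t \<in> realization P R \<Longrightarrow> is_finite_chain P R {x. t x \<noteq> 0}"
  by (simp add: realization_def is_finite_chain_def)

lemma continuous_map_geom_real:
  assumes "\<And>\<sigma>. is_finite_chain P R \<sigma> \<Longrightarrow>
      continuous_map (subtopology (powertop_real UNIV) (closed_simplex P R \<sigma>)) Y f"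
  shows "continuous_map (geom_real P R) Y f"
  unfolding continuous_map_def
proof (intro conjI allI impI)
  show "f \<in> topspace (geom_real P R) \<rightarrow> topspace Y"
  proof
    fix t assume "t \<in> topspace (geom_real P R)"
    then have t: "t \<in> realization P R" by (simp add: topspace_geom_real)
    then have "t \<in> closed_simplex P R {x. t x \<noteq> 0}" by (simp add: closed_simplex_def)
    then show "f t \<in> topspace Y"
      using assms[OF support_finite_chain[OF t]] by (auto simp: continuous_map_def)
  qed
  fix U assume U: "openin Y U"
  show "openin (geom_real P R) {x \<in> topspace (geom_real P R). f x \<in> U}"
    unfolding openin_geom_real topspace_geom_real
  proof (intro conjI allI impI)
    fix \<sigma> assume \<sigma>: "is_finite_chain P R \<sigma>"
    have "{x \<in> realization P R. f x \<in> U} \<inter> closed_simplex P R \<sigma>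
        = {x \<in> topspace (subtopology (powertop_real UNIV) (closed_simplex P R \<sigma>)). f x \<in> U}"
      by (auto simp: closed_simplex_def)
    then show "openin (subtopology (powertop_real UNIV) (closed_simplex P R \<sigma>))
        ({x \<in> realization P R. f x \<in> U} \<inter> closed_simplex P R \<sigma>)"
      using openin_continuous_map_preimage[OF assms[OF \<sigma>] U] by simp
  qed auto
qed

lemma continuous_map_into_geom_real:
  assumes f: "continuous_map X (subtopology (powertop_real UNIV) (closed_simplex P R \<sigma>)) f"
    and \<sigma>: "is_finite_chain P R \<sigma>"
  shows "continuous_map X (geom_real P R) f"
  unfolding continuous_map_def
proof (intro conjI allI impI)
  have mem: "f x \<in> closed_simplex P R \<sigma>" if "x \<in> topspace X" for x
    using f that by (auto simp: continuous_map_def)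
  then show "f \<in> topspace X \<rightarrow> topspace (geom_real P R)"
    by (auto simp: topspace_geom_real closed_simplex_def)
  fix U assume "openin (geom_real P R) U"
  then have "openin (subtopology (powertop_real UNIV) (closed_simplex P R \<sigma>)) (U \<inter> closed_simplex P R \<sigma>)"
    using \<sigma> by (simp add: openin_geom_real)
  then have "openin X {x \<in> topspace X. f x \<in> U \<inter> closed_simplex P R \<sigma>}"
    by (rule openin_continuous_map_preimage[OF f])
  moreover have "{x \<in> topspace X. f x \<in> U \<inter> closed_simplex P R \<sigma>} = {x \<in> topspace X. f x \<in> U}"
    using mem by blast
  ultimately show "openin X {x \<in> topspace X. f x \<in> U}" by simp
qed

context
  fixes G :: "('g, 'm) monoid_scheme" and P :: "'a set" and R :: "'a rel" and act :: "'g \<Rightarrow> 'a \<Rightarrow> 'a"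
  assumes GP: "G_poset G P R act"
begin

interpretation group_action G P act
  using GP by (simp add: G_poset_def)

lemma group_G: "group G"
  using group_hom by (simp add: group_hom_def)

lemma act_closed: "g \<in> carrier G \<Longrightarrow> x \<in> P \<Longrightarrow> act g x \<in> P"
  using element_image by blast

lemma act_one: "x \<in> P \<Longrightarrow> act \<one>\<^bsub>G\<^esub> x = x"
  using id_eq_one by (metis restrict_apply')

lemma act_inv: "g \<in> carrier G \<Longrightarrow> x \<in> P \<Longrightarrow> act (inv\<^bsub>G\<^esub> g) (act g x) = x"
  using orbit_sym_aux by blast

lemma act_inv': "g \<in> carrier G \<Longrightarrow> x \<in> P \<Longrightarrow> act g (act (inv\<^bsub>G\<^esub> g) x) = x"
  using act_inv[of "inv\<^bsub>G\<^esub> g" x] group.inv_inv[OF group_G] group.inv_closed[OF group_G] by simp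

lemma act_mono: "g \<in> carrier G \<Longrightarrow> x \<in> P \<Longrightarrow> y \<in> P \<Longrightarrow> (x, y) \<in> R \<Longrightarrow> (act g x, act g y) \<in> R"
  using GP by (simp add: G_poset_def)

lemma act_comparable:
  "g \<in> carrier G \<Longrightarrow> x \<in> P \<Longrightarrow> y \<in> P \<Longrightarrow> comparable R x y \<Longrightarrow> comparable R (act g x) (act g y)"
  using act_mono unfolding comparable_def by blast

lemma comparable_same_orbit_imp_eq:
  assumes fin: "finite (carrier G)" and g: "g \<in> carrier G" and x: "x \<in> P" and "comparable R x (act g x)"
  shows "act g x = x"
proof -
  interpret G: group G by (rule group_G)
  have tr: "trans R" and an: "antisym R" and re: "refl_on P R"
    using GP by (auto simp: G_poset_def partial_order_on_def preorder_on_def)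
  have le: "act h x = x" if h: "h \<in> carrier G" "(x, act h x) \<in> R" for h
  proof -
    have step: "(act h x, act (h [^]\<^bsub>G\<^esub> Suc k) x) \<in> R" for k
    proof (induction k)
      case 0
      then show ?case using act_closed[OF h(1) x] re h by (simp add: refl_on_def)
    next
      case (Suc k)
      have "act (h [^]\<^bsub>G\<^esub> Suc (Suc k)) x = act (h [^]\<^bsub>G\<^esub> Suc k) (act h x)"
        using composition_rule[OF x, of "h [^]\<^bsub>G\<^esub> Suc k" h] h by simp
      moreover have "(act (h [^]\<^bsub>G\<^esub> Suc k) x, act (h [^]\<^bsub>G\<^esub> Suc k) (act h x)) \<in> R"
        using h x act_closed by (intro act_mono) auto
      ultimately show ?case using Suc tr by (metis transD)
    qed
    have "h [^]\<^bsub>G\<^esub> Suc (G.ord h - 1) = \<one>\<^bsub>G\<^esub>"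
      using G.ord_ge_1[OF fin h(1)] G.pow_ord_eq_1[OF h(1)] by simp
    then have "(act h x, x) \<in> R" using step[of "G.ord h - 1"] act_one[OF x] by simp
    then show ?thesis using h an by (auto dest: antisymD)
  qed
  show ?thesis
  proof (cases "(x, act g x) \<in> R")
    case True
    then show ?thesis using le g by blast
  next
    case False
    then have "(act g x, x) \<in> R" using assms by (simp add: comparable_def)
    then have "(act (inv\<^bsub>G\<^esub> g) (act g x), act (inv\<^bsub>G\<^esub> g) x) \<in> R"
      using g x act_closed by (intro act_mono) auto
    then have "(x, act (inv\<^bsub>G\<^esub> g) x) \<in> R" using act_inv[OF g x] by simp
    then have "act (inv\<^bsub>G\<^esub> g) x = x" using le g by simp
    then show ?thesis using act_inv'[OF g x] by simp
  qed
qed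

lemma real_act_apply: "g \<in> carrier G \<Longrightarrow> x \<in> P \<Longrightarrow> real_act G P act g t (act g x) = t x"
  by (simp add: real_act_def act_closed act_inv)

lemma support_real_act:
  assumes g: "g \<in> carrier G" and t: "{x. t x \<noteq> 0} \<subseteq> P"
  shows "{y. real_act G P act g t y \<noteq> 0} = act g ` {x. t x \<noteq> 0}"
proof
  show "act g ` {x. t x \<noteq> 0} \<subseteq> {y. real_act G P act g t y \<noteq> 0}"
    using real_act_apply[OF g, of _ t] t by (auto simp: subset_iff)
  show "{y. real_act G P act g t y \<noteq> 0} \<subseteq> act g ` {x. t x \<noteq> 0}"
  proof
    fix y assume "y \<in> {y. real_act G P act g t y \<noteq> 0}"
    then have "y \<in> P" "t (act (inv\<^bsub>G\<^esub> g) y) \<noteq> 0" by (auto simp: real_act_def split: if_splits)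
    then show "y \<in> act g ` {x. t x \<noteq> 0}" using act_inv'[OF g, of y] by (intro image_eqI[of _ _ "act (inv\<^bsub>G\<^esub> g) y"]) auto
  qed
qed

lemma is_finite_chain_act:
  "g \<in> carrier G \<Longrightarrow> is_finite_chain P R \<sigma> \<Longrightarrow> is_finite_chain P R (act g ` \<sigma>)"
  unfolding is_finite_chain_def using act_closed act_comparable by (auto simp: subset_iff)

lemma real_act_closed_simplex:
  assumes g: "g \<in> carrier G" and t: "t \<in> closed_simplex P R \<sigma>"
  shows "real_act G P act g t \<in> closed_simplex P R (act g ` \<sigma>)"
proof -
  have tr: "t \<in> realization P R" and ts: "{x. t x \<noteq> 0} \<subseteq> \<sigma>" using t by (auto simp: closed_simplex_def)
  have tP: "{x. t x \<noteq> 0} \<subseteq> P" using tr by (simp add: realization_def)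
  note supp = support_real_act[OF g tP]
  have "is_finite_chain P R {y. real_act G P act g t y \<noteq> 0}"
    unfolding supp by (rule is_finite_chain_act[OF g support_finite_chain[OF tr]])
  moreover have "0 \<le> real_act G P act g t y" for y
    using tr by (simp add: real_act_def realization_def)
  moreover have "sum (real_act G P act g t) {y. real_act G P act g t y \<noteq> 0} = 1"
  proof -
    have "inj_on (act g) {x. t x \<noteq> 0}" using inj_prop[OF g] tP inj_on_subset by blast
    then have "sum (real_act G P act g t) (act g ` {x. t x \<noteq> 0}) = (\<Sum>x | t x \<noteq> 0. t x)"
      using real_act_apply[OF g] tP by (simp add: sum.reindex subset_iff)
    then show ?thesis using tr by (simp add: supp realization_def)
  qed
  ultimately have "real_act G P act g t \<in> realization P R"
    unfolding realization_def is_finite_chain_def by simp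
  then show ?thesis using ts supp by (auto simp: closed_simplex_def)
qed

lemma continuous_map_real_act:
  assumes g: "g \<in> carrier G"
  shows "continuous_map (geom_real P R) (geom_real P R) (real_act G P act g)"
proof (rule continuous_map_geom_real)
  fix \<sigma> assume \<sigma>: "is_finite_chain P R \<sigma>"
  have "continuous_map (subtopology (powertop_real UNIV) (closed_simplex P R \<sigma>)) euclideanreal
      (\<lambda>t. real_act G P act g t y)" for y
    by (cases "y \<in> P") (auto simp: real_act_def intro!: continuous_intros)
  then have "continuous_map (subtopology (powertop_real UNIV) (closed_simplex P R \<sigma>))
      (subtopology (powertop_real UNIV) (closed_simplex P R (act g ` \<sigma>))) (real_act G P act g)"
    using real_act_closed_simplex[OF g]
    by (auto simp: continuous_map_in_subtopology continuous_map_componentwise_UNIV)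
  then show "continuous_map (subtopology (powertop_real UNIV) (closed_simplex P R \<sigma>)) (geom_real P R) (real_act G P act g)"
    by (rule continuous_map_into_geom_real[OF _ is_finite_chain_act[OF g \<sigma>]])
qed

lemma real_act_mult:
  assumes "g \<in> carrier G" "h \<in> carrier G"
  shows "real_act G P act (g \<otimes>\<^bsub>G\<^esub> h) t = real_act G P act g (real_act G P act h t)"
proof -
  interpret G: group G by (rule group_G)
  show ?thesis
    using assms act_closed composition_rule
    by (auto simp: real_act_def fun_eq_iff G.inv_mult_group)
qed

lemma real_act_one:
  assumes "t \<in> realization P R"
  shows "real_act G P act \<one>\<^bsub>G\<^esub> t = t"
proof
  interpret G: group G by (rule group_G)
  fix y
  have "t y = 0" if "y \<notin> P" using assms that by (auto simp: realization_def)
  then show "real_act G P act \<one>\<^bsub>G\<^esub> t y = t y"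
    using act_one by (simp add: real_act_def)
qed

lemma real_act_funpow:
  assumes "g \<in> carrier G" "t \<in> realization P R"
  shows "(real_act G P act g ^^ k) t = real_act G P act (g [^]\<^bsub>G\<^esub> k) t"
proof -
  interpret G: group G by (rule group_G)
  show ?thesis
  proof (induction k)
    case (Suc k)
    have "g [^]\<^bsub>G\<^esub> Suc k = g \<otimes>\<^bsub>G\<^esub> g [^]\<^bsub>G\<^esub> k"
      using assms G.nat_pow_Suc2 by blast
    then show ?case using Suc assms by (simp add: real_act_mult del: nat_pow_Suc)
  qed (use assms real_act_one in simp)
qed

end

definition label_weight :: "('a \<Rightarrow> 'l) \<Rightarrow> 'l \<Rightarrow> ('a \<Rightarrow> real) \<Rightarrow> real" where
  "label_weight lab l t = (\<Sum>x | t x \<noteq> 0 \<and> lab x = l. t x)"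

lemma continuous_map_label_weight: "continuous_map (geom_real P R) euclideanreal (label_weight lab l)"
proof (rule continuous_map_geom_real)
  fix \<sigma> assume "is_finite_chain P R \<sigma>"
  then have fin: "finite \<sigma>" by (simp add: is_finite_chain_def)
  have "continuous_map (subtopology (powertop_real UNIV) (closed_simplex P R \<sigma>)) euclideanreal
      (\<lambda>t. \<Sum>x\<in>{x \<in> \<sigma>. lab x = l}. t x)"
    using fin by (intro continuous_intros) auto
  moreover have "label_weight lab l t = (\<Sum>x\<in>{x \<in> \<sigma>. lab x = l}. t x)" if "t \<in> closed_simplex P R \<sigma>" for t
    unfolding label_weight_def using fin that
    by (intro sum.mono_neutral_left) (auto simp: closed_simplex_def)
  ultimately show "continuous_map (subtopology (powertop_real UNIV) (closed_simplex P R \<sigma>)) euclideanreal (label_weight lab l)"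
    by (auto elim!: continuous_map_eq)
qed

lemma sum_label_weight:
  assumes "t \<in> realization P R" "lab ` P \<subseteq> L" "finite L"
  shows "(\<Sum>l\<in>L. label_weight lab l t) = 1"
proof -
  have t: "finite {x. t x \<noteq> 0}" "{x. t x \<noteq> 0} \<subseteq> P" "sum t {x. t x \<noteq> 0} = 1"
    using assms(1) by (auto simp: realization_def)
  have "(\<Sum>l\<in>L. sum t {x \<in> {x. t x \<noteq> 0}. lab x = l}) = sum t {x. t x \<noteq> 0}"
    by (rule sum.group) (use t assms in auto)
  then show ?thesis using t by (simp add: label_weight_def)
qed

lemma label_weight_pos:
  assumes "label_weight lab l t > 0"
  obtains x where "t x \<noteq> 0" "lab x = l"
  using assms unfolding label_weight_def by (metis (mono_tags, lifting) less_irrefl mem_Collect_eq sum.neutral)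

lemma label_weight_exclusive:
  assumes t: "t \<in> realization P R"
    and lab: "\<And>x y. x \<in> P \<Longrightarrow> y \<in> P \<Longrightarrow> comparable R x y \<Longrightarrow> snd (lab x) = snd (lab y) \<Longrightarrow> lab x = lab y"
    and "label_weight lab (j, i) t > 0" "label_weight lab (j', i) t > 0"
  shows "j = j'"
proof -
  obtain x y where x: "t x \<noteq> 0" "lab x = (j, i)" and y: "t y \<noteq> 0" "lab y = (j', i)"
    using label_weight_pos assms(3,4) by metis
  then have "x \<in> P" "y \<in> P" "comparable R x y" using t by (auto simp: realization_def)
  then have "lab x = lab y" using lab[of x y] x y by simp
  then show ?thesis using x y by simp
qed

lemma label_weight_shift:
  assumes GP: "G_poset G P R act" and g: "g \<in> carrier G" and t: "t \<in> realization P R"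
    and lab: "\<And>x. x \<in> P \<Longrightarrow> lab (act g x) = shift m (lab x)" "\<And>x. x \<in> P \<Longrightarrow> fst (lab x) < m"
    and l: "fst l < m"
  shows "label_weight lab (shift m l) (real_act G P act g t) = label_weight lab l t"
proof -
  have tP: "{x. t x \<noteq> 0} \<subseteq> P" using t by (simp add: realization_def)
  have inj: "l' = l" if "fst l' < m" "shift m l' = shift m l" for l'
  proof -
    have "Suc (fst l') mod m = Suc (fst l) mod m" "snd l' = snd l" using that by (auto simp: shift_def)
    then have "fst l' = fst l" using l that by (auto simp: mod_Suc split: if_splits)
    then show ?thesis using \<open>snd l' = snd l\<close> by (simp add: prod_eq_iff)
  qed
  have "{y. real_act G P act g t y \<noteq> 0 \<and> lab y = shift m l} = {y \<in> act g ` {x. t x \<noteq> 0}. lab y = shift m l}"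
    using support_real_act[OF GP g tP] by blast
  also have "\<dots> = act g ` {x. t x \<noteq> 0 \<and> lab x = l}"
  proof -
    have "lab (act g x) = shift m l \<longleftrightarrow> lab x = l" if "t x \<noteq> 0" for x
    proof -
      have "x \<in> P" using that tP by blast
      then show ?thesis using lab(1)[of x] lab(2)[of x] inj[of "lab x"] by metis
    qed
    then show ?thesis by blast
  qed
  finally have supp: "{y. real_act G P act g t y \<noteq> 0 \<and> lab y = shift m l} = act g ` {x. t x \<noteq> 0 \<and> lab x = l}" .
  have "inj_on (act g) P"
    using GP g group_action.inj_prop by (fastforce simp: G_poset_def)
  then have "inj_on (act g) {x. t x \<noteq> 0 \<and> lab x = l}" using tP by (auto intro: inj_on_subset)
  then show ?thesis
    unfolding label_weight_def supp
    using real_act_apply[OF GP g] tP by (simp add: sum.reindex subset_iff)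
qed

text \<open>Pick a representative of every orbit of the cyclic group generated by \<open>\<tau>\<close>; the label of
  \<open>\<tau>\<^sup>j r\<close> is \<open>j\<close> together with the colour of the representative \<open>r\<close>.\<close>

lemma cyclic_labelling:
  fixes G :: "('g, 'm) monoid_scheme"
  assumes fin: "finite (carrier G)" and Q: "free_G_poset G Q R act"
    and \<tau>: "\<tau> \<in> carrier G"
    and col: "\<And>x. x \<in> Q \<Longrightarrow> c x < Suc n"
      "\<And>x y. x \<in> Q \<Longrightarrow> y \<in> Q \<Longrightarrow> strong_compat_adj G Q R act x y \<Longrightarrow> c x \<noteq> c y"
  defines "m \<equiv> group.ord G \<tau>"
  obtains lab where "lab ` Q \<subseteq> {..<m} \<times> {..n}" "\<And>x. x \<in> Q \<Longrightarrow> lab (act \<tau> x) = shift m (lab x)"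
    "\<And>x y. x \<in> Q \<Longrightarrow> y \<in> Q \<Longrightarrow> comparable R x y \<Longrightarrow> snd (lab x) = snd (lab y) \<Longrightarrow> lab x = lab y"
proof -
  have GP: "G_poset G Q R act" and free: "\<And>g x. g \<in> carrier G \<Longrightarrow> x \<in> Q \<Longrightarrow> act g x = x \<Longrightarrow> g = \<one>\<^bsub>G\<^esub>"
    using Q by (auto simp: free_G_poset_def)
  interpret G: group G by (rule group_G[OF GP])
  interpret A: group_action G Q act using GP by (simp add: G_poset_def)
  have m1: "m \<ge> 1" unfolding m_def by (rule G.ord_ge_1[OF fin \<tau>])
  have pw: "\<tau> [^]\<^bsub>G\<^esub> k \<in> carrier G" for k :: nat using \<tau> by simp
  have pw_mod: "\<tau> [^]\<^bsub>G\<^esub> (k mod m) = \<tau> [^]\<^bsub>G\<^esub> k" for k :: nat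
  proof -
    have "\<tau> [^]\<^bsub>G\<^esub> k = \<tau> [^]\<^bsub>G\<^esub> (m * (k div m) + k mod m)" by simp
    also have "\<dots> = (\<tau> [^]\<^bsub>G\<^esub> m) [^]\<^bsub>G\<^esub> (k div m) \<otimes>\<^bsub>G\<^esub> \<tau> [^]\<^bsub>G\<^esub> (k mod m)"
      using \<tau> by (simp add: G.nat_pow_mult G.nat_pow_pow)
    also have "\<dots> = \<tau> [^]\<^bsub>G\<^esub> (k mod m)"
      using \<tau> by (simp add: m_def)
    finally show ?thesis by simp
  qed
  define orb where "orb x = {act (\<tau> [^]\<^bsub>G\<^esub> k) x | k::nat. True}" for x
  define rep where "rep x = (SOME y. y \<in> orb x)" for x
  have act_pow: "act (\<tau> [^]\<^bsub>G\<^esub> k) (act (\<tau> [^]\<^bsub>G\<^esub> l) x) = act (\<tau> [^]\<^bsub>G\<^esub> (k + l)) x" if "x \<in> Q" for k l :: nat and x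
    using A.composition_rule[OF that pw[of k] pw[of l]] \<tau> by (simp add: G.nat_pow_mult)
  have self: "x \<in> orb x" if "x \<in> Q" for x
  proof -
    have "x = act (\<tau> [^]\<^bsub>G\<^esub> (0::nat)) x" using act_one[OF GP that] by simp
    then show ?thesis unfolding orb_def by blast
  qed
  have rep_orb: "rep x \<in> orb x" if "x \<in> Q" for x
    unfolding rep_def using self[OF that] by (rule someI)
  have repQ: "rep x \<in> Q" if "x \<in> Q" for x
    using rep_orb[OF that] act_closed[OF GP pw that] by (auto simp: orb_def)
  have ex: "\<exists>j<m. x = act (\<tau> [^]\<^bsub>G\<^esub> j) (rep x)" if x: "x \<in> Q" for x
  proof -
    obtain k where k: "rep x = act (\<tau> [^]\<^bsub>G\<^esub> (k::nat)) x" using rep_orb[OF x] by (auto simp: orb_def)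
    have "act (\<tau> [^]\<^bsub>G\<^esub> ((m * k - k) mod m)) (rep x) = act (\<tau> [^]\<^bsub>G\<^esub> (m * k - k)) (rep x)"
      by (simp only: pw_mod)
    also have "\<dots> = act (\<tau> [^]\<^bsub>G\<^esub> (m * k - k + k)) x"
      unfolding k by (rule act_pow[OF x])
    also have "\<tau> [^]\<^bsub>G\<^esub> (m * k - k + k) = \<tau> [^]\<^bsub>G\<^esub> (0::nat)"
      using m1 pw_mod[of "m * k"] by simp
    also have "act (\<tau> [^]\<^bsub>G\<^esub> (0::nat)) x = x" using act_one[OF GP x] by simp
    finally show ?thesis using m1 by (metis mod_less_divisor less_eq_Suc_le One_nat_def)
  qed
  have uniq: "j = j'" if "x \<in> Q" "j < m" "j' < m" "act (\<tau> [^]\<^bsub>G\<^esub> j) x = act (\<tau> [^]\<^bsub>G\<^esub> j') x" for j j' x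
  proof -
    have "act (inv\<^bsub>G\<^esub> (\<tau> [^]\<^bsub>G\<^esub> j) \<otimes>\<^bsub>G\<^esub> \<tau> [^]\<^bsub>G\<^esub> j') x = x"
      using A.composition_rule[OF that(1), of "inv\<^bsub>G\<^esub> (\<tau> [^]\<^bsub>G\<^esub> j)"] pw act_inv[OF GP pw that(1), of j] that(4)
      by simp
    then have "inv\<^bsub>G\<^esub> (\<tau> [^]\<^bsub>G\<^esub> j) \<otimes>\<^bsub>G\<^esub> \<tau> [^]\<^bsub>G\<^esub> j' = \<one>\<^bsub>G\<^esub>"
      using free that(1) pw by simp
    then have "\<tau> [^]\<^bsub>G\<^esub> j = \<tau> [^]\<^bsub>G\<^esub> j'"
      using pw by (metis G.inv_closed G.inv_equality G.inv_inv)
    then show ?thesis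
      using G.ord_inj[OF \<tau>] that(2,3) unfolding inj_on_def m_def by force
  qed
  define lab where "lab x = ((THE j. j < m \<and> x = act (\<tau> [^]\<^bsub>G\<^esub> j) (rep x)), c (rep x))" for x
  have lab_eq: "lab x = (j, c (rep x))" if "x \<in> Q" "j < m" "x = act (\<tau> [^]\<^bsub>G\<^esub> j) (rep x)" for x j
    unfolding lab_def using uniq[OF repQ[OF that(1)]] that
    by (auto intro!: the_equality)
  show thesis
  proof
    show "lab ` Q \<subseteq> {..<m} \<times> {..n}"
      using ex lab_eq col(1) repQ by (fastforce simp: less_Suc_eq_le)
    show "lab (act \<tau> x) = shift m (lab x)" if x: "x \<in> Q" for x
    proof -
      have tx: "act \<tau> x \<in> Q" by (rule act_closed[OF GP \<tau> x])
      have t1: "act \<tau> x = act (\<tau> [^]\<^bsub>G\<^esub> (1::nat)) x" using \<tau> by simp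
      have "orb (act \<tau> x) = orb x"
      proof
        show "orb (act \<tau> x) \<subseteq> orb x"
          unfolding orb_def t1 act_pow[OF x] by blast
        show "orb x \<subseteq> orb (act \<tau> x)"
        proof
          fix y assume "y \<in> orb x"
          then obtain k where k: "y = act (\<tau> [^]\<^bsub>G\<^esub> (k::nat)) x" by (auto simp: orb_def)
          have "\<tau> [^]\<^bsub>G\<^esub> (k + (m - 1) + 1) = \<tau> [^]\<^bsub>G\<^esub> k"
            using m1 pw_mod[of "k + m"] pw_mod[of k] by simp
          then have "y = act (\<tau> [^]\<^bsub>G\<^esub> (k + (m - 1))) (act \<tau> x)"
            unfolding t1 act_pow[OF x] k by simp
          then show "y \<in> orb (act \<tau> x)" unfolding orb_def by blast
        qed
      qed
      then have rep: "rep (act \<tau> x) = rep x" by (simp add: rep_def)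
      obtain j where j: "j < m" "x = act (\<tau> [^]\<^bsub>G\<^esub> j) (rep x)" using ex[OF x] by blast
      have "act \<tau> x = act (\<tau> [^]\<^bsub>G\<^esub> (1 + j)) (rep x)"
        using act_pow[OF repQ[OF x], of 1 j] j(2) \<tau> by simp
      also have "\<dots> = act (\<tau> [^]\<^bsub>G\<^esub> (Suc j mod m)) (rep (act \<tau> x))"
        using pw_mod[of "Suc j"] rep by simp
      finally have "lab (act \<tau> x) = (Suc j mod m, c (rep x))"
        using lab_eq[OF tx, of "Suc j mod m"] m1 rep by simp
      then show ?thesis using lab_eq[OF x j] by (simp add: shift_def)
    qed
    show "lab x = lab y" if x: "x \<in> Q" and y: "y \<in> Q" and xy: "comparable R x y" "snd (lab x) = snd (lab y)" for x y
    proof (rule ccontr)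
      assume neq: "lab x \<noteq> lab y"
      obtain j where j: "j < m" "x = act (\<tau> [^]\<^bsub>G\<^esub> j) (rep x)" using ex[OF x] by blast
      obtain k where k: "k < m" "y = act (\<tau> [^]\<^bsub>G\<^esub> k) (rep y)" using ex[OF y] by blast
      have c: "c (rep x) = c (rep y)" using xy(2) lab_eq[OF x j] lab_eq[OF y k] by simp
      then have jk: "j \<noteq> k" using neq lab_eq[OF x j] lab_eq[OF y k] by auto
      let ?g = "inv\<^bsub>G\<^esub> (\<tau> [^]\<^bsub>G\<^esub> j) \<otimes>\<^bsub>G\<^esub> \<tau> [^]\<^bsub>G\<^esub> k"
      have "comparable R (act (inv\<^bsub>G\<^esub> (\<tau> [^]\<^bsub>G\<^esub> j)) x) (act (inv\<^bsub>G\<^esub> (\<tau> [^]\<^bsub>G\<^esub> j)) y)"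
        using x y xy(1) pw by (intro act_comparable[OF GP]) auto
      moreover have "act (inv\<^bsub>G\<^esub> (\<tau> [^]\<^bsub>G\<^esub> j)) x = rep x"
        using act_inv[OF GP pw repQ[OF x], of j] j(2) by simp
      moreover have "act (inv\<^bsub>G\<^esub> (\<tau> [^]\<^bsub>G\<^esub> j)) y = act ?g (rep y)"
        using A.composition_rule[OF repQ[OF y], of "inv\<^bsub>G\<^esub> (\<tau> [^]\<^bsub>G\<^esub> j)" "\<tau> [^]\<^bsub>G\<^esub> k"] pw k(2) by simp
      ultimately have comp: "comparable R (rep x) (act ?g (rep y))" by simp
      have g: "?g \<in> carrier G" using pw by simp
      have g1: "?g \<noteq> \<one>\<^bsub>G\<^esub>"
      proof
        assume "?g = \<one>\<^bsub>G\<^esub>"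
        then have "\<tau> [^]\<^bsub>G\<^esub> j = \<tau> [^]\<^bsub>G\<^esub> k"
          using pw by (metis G.inv_closed G.inv_equality G.inv_inv)
        then show False using uniq[OF x j(1) k(1)] jk by simp
      qed
      have "rep y \<in> orbit G act (rep x)"
      proof (rule ccontr)
        assume "rep y \<notin> orbit G act (rep x)"
        then have "strong_compat_adj G Q R act (rep x) (rep y)"
          using repQ x y comp g g1 by (auto simp: strong_compat_adj_def)
        then show False using col(2) repQ x y c by blast
      qed
      then obtain h where h: "h \<in> carrier G" "rep y = act h (rep x)" by (auto simp: orbit_def)
      have "act ?g (rep y) = act (?g \<otimes>\<^bsub>G\<^esub> h) (rep x)"
        using A.composition_rule[OF repQ[OF x] g h(1)] h(2) by simp
      then have "act ?g (rep y) = rep x"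
        using comparable_same_orbit_imp_eq[OF GP fin _ repQ[OF x], of "?g \<otimes>\<^bsub>G\<^esub> h"] comp g h(1) by simp
      then have "act (inv\<^bsub>G\<^esub> (\<tau> [^]\<^bsub>G\<^esub> j)) y = act (inv\<^bsub>G\<^esub> (\<tau> [^]\<^bsub>G\<^esub> j)) x"
        using \<open>act (inv\<^bsub>G\<^esub> (\<tau> [^]\<^bsub>G\<^esub> j)) x = rep x\<close> \<open>act (inv\<^bsub>G\<^esub> (\<tau> [^]\<^bsub>G\<^esub> j)) y = act ?g (rep y)\<close> by simp
      then have "x = y" using act_inv'[OF GP pw x, of j] act_inv'[OF GP pw y, of j] by simp
      then show False using neq by simp
    qed
  qed
qed

theorem theorem9:
  fixes G :: "('g, 'm) monoid_scheme"
    and P :: "'a set" and leP :: "'a rel" and actP :: "'g \<Rightarrow> 'a \<Rightarrow> 'a"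
    and Q :: "'b set" and leQ :: "'b rel" and actQ :: "'g \<Rightarrow> 'b \<Rightarrow> 'b"
    and n :: int
  assumes "group G" and "finite (carrier G)" and "carrier G \<noteq> {\<one>\<^bsub>G\<^esub>}"
    and "G_poset G P leP actP"
    and "n_connected n (geom_real P leP)"
    and "free_G_poset G Q leQ actQ"
    and "chromatic_le Q (strong_compat_adj G Q leQ actQ) (n + 1)"
  shows "(\<nexists>f. continuous_map (geom_real P leP) (geom_real Q leQ) f \<and>
               (\<forall>g\<in>carrier G. \<forall>t\<in>topspace (geom_real P leP).
                   f (real_act G P actP g t) = real_act G Q actQ g (f t)))
     \<and> (\<forall>lam. lam \<in> P \<rightarrow> Q \<and> (\<forall>g\<in>carrier G. \<forall>x\<in>P. lam (actP g x) = actQ g (lam x)) \<longrightarrow>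
           (\<exists>x\<in>P. \<exists>y\<in>P. comparable leP x y \<and> \<not> comparable leQ (lam x) (lam y)))"
proof -
  interpret G: group G by fact
  note GP = assms(4)
  have GQ: "G_poset G Q leQ actQ" using assms(6) by (simp add: free_G_poset_def)
  obtain k c where k: "int k \<le> n + 1" "\<And>x. x \<in> Q \<Longrightarrow> c x < k"
      "\<And>x y. x \<in> Q \<Longrightarrow> y \<in> Q \<Longrightarrow> strong_compat_adj G Q leQ actQ x y \<Longrightarrow> c x \<noteq> c y"
    using assms(7) unfolding chromatic_le_def colorable_def by blast
  have X: "topspace (geom_real P leP) \<noteq> {}"
    using assms(5) k(1) by (simp add: n_connected_def)
  have P: "P \<noteq> {}"
  proof
    assume "P = {}"
    then have "realization P leP = {}" by (auto simp: realization_def)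
    then show False using X by (simp add: topspace_geom_real)
  qed
  show ?thesis
  proof (cases "n = -1")
    case True
    then have "k = 0" using k(1) by simp
    then have Q: "Q = {}" using k(2) by fastforce
    then have "realization Q leQ = {}" by (auto simp: realization_def)
    then have "\<not> continuous_map (geom_real P leP) (geom_real Q leQ) f" for f
      using X by (auto simp: continuous_map_def topspace_geom_real)
    moreover have "lam \<notin> P \<rightarrow> Q" for lam using P Q by auto
    ultimately show ?thesis by blast
  next
    case False
    define N where "N = nat n"
    have nN: "n = int N" using False k(1) by (simp add: N_def)
    have triv: "homotopy_group_trivial (geom_real P leP) q x"
      if "q \<le> N" "x \<in> topspace (geom_real P leP)" for q x
      using assms(5) that nN by (simp add: n_connected_def)
    have cN: "c x < Suc N" if "x \<in> Q" for x using k(1) k(2)[OF that] nN by simp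
    obtain \<tau> where \<tau>: "\<tau> \<in> carrier G" "\<tau> \<noteq> \<one>\<^bsub>G\<^esub>" using assms(3) G.one_closed by blast
    define m where "m = G.ord \<tau>"
    have m: "m \<ge> 2"
      using G.ord_ge_1[OF assms(2) \<tau>(1)] G.ord_eq_1[OF \<tau>(1)] \<tau>(2) by (simp add: m_def)
    obtain lab where lab: "lab ` Q \<subseteq> {..<m} \<times> {..N}"
      and lab_shift: "\<And>x. x \<in> Q \<Longrightarrow> lab (actQ \<tau> x) = shift m (lab x)"
      and lab_compat: "\<And>x y. x \<in> Q \<Longrightarrow> y \<in> Q \<Longrightarrow> comparable leQ x y \<Longrightarrow> snd (lab x) = snd (lab y) \<Longrightarrow> lab x = lab y"
      using cyclic_labelling[of G Q leQ actQ \<tau> c N, OF assms(2,6) \<tau>(1) cN k(3)] unfolding m_def by blast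
    have lab_fst: "fst (lab x) < m" if "x \<in> Q" for x using lab that by force
    let ?T = "real_act G P actP \<tau>"
    have T: "continuous_map (geom_real P leP) (geom_real P leP) ?T"
      by (rule continuous_map_real_act[OF GP \<tau>(1)])
    have per: "(?T ^^ m) t = t" if "t \<in> topspace (geom_real P leP)" for t
      using that real_act_funpow[OF GP \<tau>(1)] real_act_one[OF GP] \<tau>(1)
      by (simp add: topspace_geom_real m_def)
    note no_map = no_equivariant_map_to_join[of m N "geom_real P leP" ?T, OF m triv X T per]
    have "\<not> (continuous_map (geom_real P leP) (geom_real Q leQ) f \<and>
               (\<forall>g\<in>carrier G. \<forall>t\<in>topspace (geom_real P leP).
                   f (real_act G P actP g t) = real_act G Q actQ g (f t)))" for f
    proof
      assume f: "continuous_map (geom_real P leP) (geom_real Q leQ) f \<and>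
               (\<forall>g\<in>carrier G. \<forall>t\<in>topspace (geom_real P leP).
                   f (real_act G P actP g t) = real_act G Q actQ g (f t))"
      then have fQ: "f t \<in> realization Q leQ" if "t \<in> topspace (geom_real P leP)" for t
        using that by (auto simp: continuous_map_def topspace_geom_real)
      show False
      proof (rule no_map[of "\<lambda>l. label_weight lab l \<circ> f"])
        show "continuous_map (geom_real P leP) euclideanreal (label_weight lab l \<circ> f)" for l
          using f continuous_map_label_weight by (intro continuous_map_compose) auto
        show "(\<Sum>l\<in>{..<m} \<times> {..N}. (label_weight lab l \<circ> f) t) = 1"
          if "t \<in> topspace (geom_real P leP)" for t
          using sum_label_weight[OF fQ[OF that] lab] by simp
        show "j = j'" if "t \<in> topspace (geom_real P leP)"
          "(label_weight lab (j, i) \<circ> f) t > 0" "(label_weight lab (j', i) \<circ> f) t > 0" for t j j' i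
          using label_weight_exclusive[where lab = lab and P = Q and R = leQ, OF fQ[OF that(1)]] lab_compat that(2,3)
          unfolding o_def by blast
        show "(label_weight lab (shift m l) \<circ> f) (?T t) = (label_weight lab l \<circ> f) t"
          if "t \<in> topspace (geom_real P leP)" "fst l < m" for t l
          using label_weight_shift[where lab = lab and m = m, OF GQ \<tau>(1) fQ[OF that(1)] lab_shift lab_fst that(2)] f \<tau>(1) that(1) by simp
      qed
    qed
    moreover have "\<exists>x\<in>P. \<exists>y\<in>P. comparable leP x y \<and> \<not> comparable leQ (lam x) (lam y)"
      if lam: "lam \<in> P \<rightarrow> Q" "\<forall>g\<in>carrier G. \<forall>x\<in>P. lam (actP g x) = actQ g (lam x)" for lam
    proof (rule ccontr)
      assume "\<not> ?thesis"
      then have mono: "comparable leQ (lam x) (lam y)" if "x \<in> P" "y \<in> P" "comparable leP x y" for x y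
        using that by blast
      have lamQ: "lam x \<in> Q" if "x \<in> P" for x using lam(1) that by blast
      define l' where "l' = lab \<circ> lam"
      have l'_compat: "l' x = l' y" if "x \<in> P" "y \<in> P" "comparable leP x y" "snd (l' x) = snd (l' y)" for x y
        using that lab_compat[OF lamQ lamQ mono] by (simp add: l'_def)
      have l'_img: "l' ` P \<subseteq> {..<m} \<times> {..N}" using lab lamQ by (auto simp: l'_def)
      have l'_fst: "fst (l' x) < m" if "x \<in> P" for x using lab_fst lamQ that by (simp add: l'_def)
      have l'_shift: "l' (actP \<tau> x) = shift m (l' x)" if "x \<in> P" for x
        using lam(2) lab_shift lamQ that \<tau>(1) by (simp add: l'_def)
      show False
      proof (rule no_map[of "label_weight l'"])
        show "continuous_map (geom_real P leP) euclideanreal (label_weight l' l)" for l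
          by (rule continuous_map_label_weight)
        show "(\<Sum>l\<in>{..<m} \<times> {..N}. label_weight l' l t) = 1" if "t \<in> topspace (geom_real P leP)" for t
          using sum_label_weight[OF _ l'_img] that by (simp add: topspace_geom_real)
        show "j = j'" if "t \<in> topspace (geom_real P leP)"
          "label_weight l' (j, i) t > 0" "label_weight l' (j', i) t > 0" for t j j' i
          using label_weight_exclusive[where lab = l' and P = P and R = leP] l'_compat that
          unfolding topspace_geom_real by blast
        show "label_weight l' (shift m l) (?T t) = label_weight l' l t"
          if "t \<in> topspace (geom_real P leP)" "fst l < m" for t l
          using label_weight_shift[where lab = l' and m = m, OF GP \<tau>(1) _ l'_shift l'_fst that(2)] that(1)
          by (simp add: topspace_geom_real)
      qed
    qed
    ultimately show ?thesis by blast
  qed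
qed

end
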